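(* Let $N\geq 2$. For every $\beta>0$ there exists a constant $K(\beta)>0$, independent of $\lambda$ and $u$, such that for all $u\in C_{0}^{\infty}(\mathbb{H}^{N})$ and all $\lambda\in(0,\beta]$, $$\frac{\lambda^{2}}{2}\int_{\mathbb{H}^{N}}|\nabla_{\mathbb{H}}u|^{2}e^{-\frac{\rho^{2}(x)}{\lambda^{2}}}dV_{\mathbb{H}}\geq K(\beta)\inf_{c\in\mathbb{R}}\int_{\mathbb{H}^{N}}|u-c|^{2}e^{-\frac{\rho^{2}(x)}{\lambda^{2}}}dV_{\mathbb{H}}.$$
   Context: $\mathbb{H}^{N}$ is the hyperbolic space in the Poincaré ball model: the Euclidean unit ball with Riemannian metric $\left(\frac{2}{1-|x|^{2}}\right)^{2}dx^{2}$, volume element $dV_{\mathbb{H}}=\left(\frac{2}{1-|x|^{2}}\right)^{N}dx$, Riemannian gradient $\nabla_{\mathbb{H}}=\left(\frac{1-|x|^{2}}{2}\right)^{2}\nabla$; $|\nabla_{\mathbb H}u|$ is the Riemannian norm. $\rho(x)=\log\frac{1+|x|}{1-|x|}$ is the hyperbolic distance from $x$ to $0$. Functions are real-valued; $C_0^\infty$ means smooth with compact support. *)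

theory Defs
  imports "HOL-Analysis.Analysis"
begin

text \<open>Poincare ball model: the underlying manifold is the open Euclidean unit ball, and
  tangent vectors at a point are identified with vectors of the ambient space.\<close>

abbreviation hyp_space :: "'a::euclidean_space set" where
  "hyp_space \<equiv> ball 0 1"

definition hyp_factor :: "'a::euclidean_space \<Rightarrow> real" where
  "hyp_factor x = 2 / (1 - (norm x)\<^sup>2)"

definition hyp_inner :: "'a::euclidean_space \<Rightarrow> 'a \<Rightarrow> 'a \<Rightarrow> real" where
  "hyp_inner x v w = (hyp_factor x)\<^sup>2 * (v \<bullet> w)"

definition hyp_norm :: "'a::euclidean_space \<Rightarrow> 'a \<Rightarrow> real" where
  "hyp_norm x v = sqrt (hyp_inner x v v)"

definition hyp_volume :: "'a::euclidean_space measure" where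
  "hyp_volume = density (restrict_space lborel hyp_space)
                        (\<lambda>x. ennreal (hyp_factor x ^ DIM('a)))"

definition euclidean_gradient :: "('a::euclidean_space \<Rightarrow> real) \<Rightarrow> 'a \<Rightarrow> 'a" where
  "euclidean_gradient u x = (THE D. GDERIV u x :> D)"

definition hyp_gradient :: "('a::euclidean_space \<Rightarrow> real) \<Rightarrow> 'a \<Rightarrow> 'a" where
  "hyp_gradient u x = ((1 - (norm x)\<^sup>2) / 2)\<^sup>2 *\<^sub>R euclidean_gradient u x"

definition hyp_rho :: "'a::euclidean_space \<Rightarrow> real" where
  "hyp_rho x = ln ((1 + norm x) / (1 - norm x))"

text \<open>On an open set \<open>S\<close>, \<open>Ck_on k S f\<close> says that \<open>f\<close> is k times continuously
  differentiable on \<open>S\<close>: the recursion runs over the partial derivatives, and continuity of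
  the lower-order derivatives follows from their differentiability.\<close>

primrec Ck_on :: "nat \<Rightarrow> 'a::euclidean_space set \<Rightarrow> ('a \<Rightarrow> real) \<Rightarrow> bool" where
  "Ck_on 0 S f \<longleftrightarrow> continuous_on S f"
| "Ck_on (Suc k) S f \<longleftrightarrow>
     (\<forall>x\<in>S. f differentiable (at x)) \<and>
     (\<forall>b\<in>Basis. Ck_on k S (\<lambda>x. frechet_derivative f (at x) b))"

definition smooth_on :: "'a::euclidean_space set \<Rightarrow> ('a \<Rightarrow> real) \<Rightarrow> bool" where
  "smooth_on S f \<longleftrightarrow> (\<forall>k. Ck_on k S f)"

text \<open>Functions on the hyperbolic space are represented by functions on the ambient space
  whose values outside the unit ball are irrelevant.  The support is a compact subset of
  the hyperbolic space iff its closure in the ambient space is compact and stays inside the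
  open ball.\<close>

definition hyp_test_functions :: "('a::euclidean_space \<Rightarrow> real) set" where
  "hyp_test_functions =
     {u. smooth_on hyp_space u \<and>
         compact (closure (support_on hyp_space u)) \<and>
         closure (support_on hyp_space u) \<subseteq> hyp_space}"

end

theory Submission
  imports Defs
begin

text \<open>Write \<open>q\<close> for the conformal factor, \<open>\<tau> = \<rho> / l\<close>, and \<open>\<mu>\<close> for the Gaussian measure with density
  \<open>exp (- \<tau>\<^sup>2)\<close> with respect to the hyperbolic volume. Integrating the radial derivative of
  \<open>f\<^sup>2 \<rho> exp (- \<tau>\<^sup>2) sinh \<rho> ^ (N - 1)\<close> along rays and using \<open>\<rho> coth \<rho> \<le> 1 + \<rho>\<close> and \<open>\<rho> \<le> \<beta> \<tau>\<close>
  gives \<open>\<integral> (\<tau>\<^sup>2 - C) f\<^sup>2 d\<mu> \<le> 2 l\<^sup>2 \<integral> |\<nabla>f|\<^sup>2 d\<mu>\<close>, where \<open>C\<close> depends only on \<open>N\<close> and \<open>\<beta>\<close>. Hence the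
  \<open>L\<^sup>2\<close> norm of \<open>f\<close> is controlled by the energy and by the part of the norm in the ball
  \<open>\<tau> < sqrt (2 C)\<close>. There the metric and the weight are comparable to the Euclidean ones, uniformly
  for \<open>l \<le> \<beta>\<close>, and the ball has diameter of order \<open>l\<close>. The Euclidean Poincare inequality for
  convex sets, applied to \<open>f = u - u y\<close> and averaged over \<open>y\<close> in that ball, concludes.\<close>

subsection \<open>Comparison of integrals along intervals and rays\<close>

text \<open>Stands in for integration by parts: a pointwise bound containing an exact derivative is
  integrated, and the boundary term \<open>F b - F a\<close> has the sign that allows dropping
  it.\<close>

lemma nn_integral_Icc_mono_deriv:
  fixes F P Q :: "real \<Rightarrow> real"
  assumes "a \<le> b" "continuous_on {a..b} P" "continuous_on {a..b} Q"
    and nonneg: "\<And>t. t \<in> {a..b} \<Longrightarrow> 0 \<le> P t" "\<And>t. t \<in> {a..b} \<Longrightarrow> 0 \<le> Q t"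
    and F: "\<And>t. t \<in> {a..b} \<Longrightarrow> (F has_real_derivative F' t) (at t)"
    and le: "\<And>t. t \<in> {a..b} \<Longrightarrow> P t \<le> Q t + F' t"
    and "F b \<le> F a"
  shows "(\<integral>\<^sup>+t\<in>{a..b}. ennreal (P t) \<partial>lborel) \<le> (\<integral>\<^sup>+t\<in>{a..b}. ennreal (Q t) \<partial>lborel)"
proof -
  have P: "(P has_integral integral {a..b} P) {a..b}" and Q: "(Q has_integral integral {a..b} Q) {a..b}"
    using assms(2,3) by (auto intro!: integrable_integral integrable_continuous_interval)
  have "(F' has_integral (F b - F a)) {a..b}"
    using F by (intro fundamental_theorem_of_calculus \<open>a \<le> b\<close>)
      (auto simp: has_real_derivative_iff_has_vector_derivative[symmetric] intro: DERIV_subset)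
  then have "integral {a..b} P \<le> integral {a..b} Q + (F b - F a)"
    using has_integral_le[OF P has_integral_add[OF Q]] le by blast
  then have "integral {a..b} P \<le> integral {a..b} Q"
    using \<open>F b \<le> F a\<close> by simp
  moreover have "(\<integral>\<^sup>+t\<in>{a..b}. ennreal (P t) \<partial>lborel) = ennreal (integral {a..b} P)"
    by (rule nn_integral_has_integral_lebesgue'[OF _ P]) (rule nonneg)
  moreover have "(\<integral>\<^sup>+t\<in>{a..b}. ennreal (Q t) \<partial>lborel) = ennreal (integral {a..b} Q)"
    by (rule nn_integral_has_integral_lebesgue'[OF _ Q]) (rule nonneg)
  ultimately show ?thesis
    by (simp add: ennreal_leI)
qed

lemma nn_integral_affine:
  fixes f :: "'a::euclidean_space \<Rightarrow> ennreal"
  assumes [measurable]: "f \<in> borel_measurable borel" and "c \<noteq> 0"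
  shows "(\<integral>\<^sup>+x. f x \<partial>lborel) = ennreal (\<bar>c\<bar> ^ DIM('a)) * (\<integral>\<^sup>+x. f (t + c *\<^sub>R x) \<partial>lborel)"
  by (subst lborel_affine[OF \<open>c \<noteq> 0\<close>, of t])
    (simp add: nn_integral_density nn_integral_distr nn_integral_cmult)

lemma nn_integral_inverse_dyadic:
  fixes r :: real
  assumes "r > 0"
  shows "(\<integral>\<^sup>+t\<in>{r/2..r}. ennreal (1 / t) \<partial>lborel) = ennreal (ln 2)"
proof -
  have "((\<lambda>t. 1 / t) has_integral (ln r - ln (r / 2))) {r/2..r}"
    using assms by (intro fundamental_theorem_of_calculus)
      (auto simp: has_real_derivative_iff_has_vector_derivative[symmetric] intro!: derivative_eq_intros)
  then show ?thesis
    using assms by (subst nn_integral_has_integral_lebesgue') (auto simp: ln_div)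
qed

text \<open>Polar coordinates, with the annulus \<open>1 \<le> norm x \<le> 2\<close> in the role of the sphere: by
  scaling invariance of \<open>dt / t\<close>, every point other than the origin lies on rays through the annulus
  with total weight \<open>ln 2\<close>.\<close>

lemma nn_integral_rays:
  fixes h :: "'a::euclidean_space \<Rightarrow> ennreal"
  assumes [measurable]: "h \<in> borel_measurable borel"
  shows "(\<integral>\<^sup>+x\<in>{x. 1 \<le> norm x \<and> norm x \<le> 2}.
            (\<integral>\<^sup>+t\<in>{0<..}. h (t *\<^sub>R x) * ennreal (t ^ (DIM('a) - 1)) \<partial>lborel) \<partial>lborel)
         = ennreal (ln 2) * (\<integral>\<^sup>+x. h x \<partial>lborel)"
proof -
  define A where "A = {x::'a. 1 \<le> norm x \<and> norm x \<le> 2}"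
  have [measurable]: "A \<in> sets borel" unfolding A_def by measurable
  \<comment> \<open>Substituting \<open>y = t *\<^sub>R x\<close> divides by
    \<open>t ^ DIM('a)\<close>, so that \<open>1 / t\<close> remains of the weight. The annulus
    becomes the condition that \<open>t\<close> lies between \<open>norm y / 2\<close> and
    \<open>norm y\<close>.\<close>
  have scale: "indicator {0<..} t * ennreal (t ^ (DIM('a) - 1)) * (\<integral>\<^sup>+x. h (t *\<^sub>R x) * indicator A x \<partial>lborel)
      = (\<integral>\<^sup>+y. h y * (ennreal (1 / t) * indicator {norm y / 2..norm y} t) * indicator {0<..} t \<partial>lborel)" for t :: real
  proof (cases "t > 0")
    case True
    have ind: "indicator A ((1/t) *\<^sub>R y) = (indicator {norm y / 2..norm y} t :: ennreal)" for y
      using True by (auto simp: A_def indicator_def field_simps)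
    have pow: "t ^ DIM('a) = t * t ^ (DIM('a) - 1)"
      by (metis DIM_positive One_nat_def Suc_diff_1 power_Suc)
    have "(\<integral>\<^sup>+y. h y * (ennreal (1 / t) * indicator {norm y / 2..norm y} t) * indicator {0<..} t \<partial>lborel)
        = ennreal (1 / t) * (\<integral>\<^sup>+y. h y * indicator A ((1/t) *\<^sub>R y) \<partial>lborel)"
      using True by (subst nn_integral_cmult[symmetric]) (auto simp: ind[symmetric] mult_ac)
    also have "\<dots> = ennreal (1 / t) * (ennreal (t ^ DIM('a)) * (\<integral>\<^sup>+x. h (t *\<^sub>R x) * indicator A x \<partial>lborel))"
      using True by (subst nn_integral_affine[where c=t and t=0]) auto
    also have "\<dots> = (ennreal (1/t) * ennreal (t ^ DIM('a))) * (\<integral>\<^sup>+x. h (t *\<^sub>R x) * indicator A x \<partial>lborel)"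
      by (simp add: mult.assoc)
    also have "ennreal (1/t) * ennreal (t ^ DIM('a)) = ennreal (t ^ (DIM('a) - 1))"
      using True by (subst ennreal_mult[symmetric]) (auto simp: pow)
    finally show ?thesis using True by simp
  qed auto
  have "(\<integral>\<^sup>+x\<in>A. (\<integral>\<^sup>+t\<in>{0<..}. h (t *\<^sub>R x) * ennreal (t ^ (DIM('a) - 1)) \<partial>lborel) \<partial>lborel)
      = (\<integral>\<^sup>+x. (\<integral>\<^sup>+t. indicator {0<..} t * ennreal (t ^ (DIM('a) - 1)) * (h (t *\<^sub>R x) * indicator A x) \<partial>lborel) \<partial>lborel)"
    by (subst nn_integral_multc[symmetric]) (auto simp: mult_ac)
  also have "\<dots> = (\<integral>\<^sup>+t. (\<integral>\<^sup>+x. indicator {0<..} t * ennreal (t ^ (DIM('a) - 1)) * (h (t *\<^sub>R x) * indicator A x) \<partial>lborel) \<partial>lborel)"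
    by (rule lborel_pair.Fubini') simp
  also have "\<dots> = (\<integral>\<^sup>+t. (\<integral>\<^sup>+y. h y * (ennreal (1 / t) * indicator {norm y / 2..norm y} t) * indicator {0<..} t \<partial>lborel) \<partial>lborel)"
    by (subst nn_integral_cmult) (auto simp: scale simp del: One_nat_def)
  also have "\<dots> = (\<integral>\<^sup>+y. (\<integral>\<^sup>+t. h y * (ennreal (1 / t) * indicator {norm y / 2..norm y} t) * indicator {0<..} t \<partial>lborel) \<partial>lborel)"
    by (rule lborel_pair.Fubini') (simp add: indicator_def)
  also have "\<dots> = (\<integral>\<^sup>+y. ennreal (ln 2) * h y \<partial>lborel)"
  \<comment> \<open>For \<open>y = 0\<close> the interval of admissible \<open>t\<close> shrinks to
    \<open>{0}\<close> and carries no weight, so the origin is removed as a null set.\<close>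
  proof (rule nn_integral_cong_AE, rule AE_mp[OF AE_lborel_singleton[of 0]], rule AE_I2, rule impI)
    fix y :: 'a assume "y \<noteq> 0"
    then have "(\<integral>\<^sup>+t. h y * (ennreal (1 / t) * indicator {norm y / 2..norm y} t) * indicator {0<..} t \<partial>lborel)
        = (\<integral>\<^sup>+t. h y * (ennreal (1 / t) * indicator {norm y / 2..norm y} t) \<partial>lborel)"
      by (intro nn_integral_cong) (auto simp: indicator_def)
    also have "\<dots> = h y * ennreal (ln 2)"
      using \<open>y \<noteq> 0\<close> by (subst nn_integral_cmult) (auto simp: nn_integral_inverse_dyadic)
    finally show "(\<integral>\<^sup>+t. h y * (ennreal (1 / t) * indicator {norm y / 2..norm y} t) * indicator {0<..} t \<partial>lborel) = ennreal (ln 2) * h y"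
      by (simp add: mult.commute)
  qed
  also have "\<dots> = ennreal (ln 2) * (\<integral>\<^sup>+x. h x \<partial>lborel)"
    by (rule nn_integral_cmult) simp
  finally show ?thesis unfolding A_def .
qed

text \<open>Reduces an inequality on the space to one dimension. The radial integral through a point
  \<open>x\<close> of the annulus is the one through \<open>sgn x\<close> times a power of
  \<open>norm x\<close> that is the same for both functions; integrating over the annulus and
  cancelling \<open>ln 2\<close> concludes.\<close>

lemma nn_integral_mono_rays:
  fixes h1 h2 :: "'a::euclidean_space \<Rightarrow> ennreal"
  assumes [measurable]: "h1 \<in> borel_measurable borel" "h2 \<in> borel_measurable borel"
    and le: "\<And>w. norm w = 1 \<Longrightarrow>
      (\<integral>\<^sup>+s\<in>{0<..}. h1 (s *\<^sub>R w) * ennreal (s ^ (DIM('a) - 1)) \<partial>lborel)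
      \<le> (\<integral>\<^sup>+s\<in>{0<..}. h2 (s *\<^sub>R w) * ennreal (s ^ (DIM('a) - 1)) \<partial>lborel)"
  shows "(\<integral>\<^sup>+x. h1 x \<partial>lborel) \<le> (\<integral>\<^sup>+x. h2 x \<partial>lborel)"
proof -
  define n where "n = DIM('a) - 1"
  \<comment> \<open>Substitution \<open>s = t * norm x\<close>: the weight contributes
    \<open>n\<close> factors \<open>1 / norm x\<close> and the differential one more.\<close>
  have unit: "(\<integral>\<^sup>+t\<in>{0<..}. h (t *\<^sub>R x) * ennreal (t ^ n) \<partial>lborel)
      = ennreal ((1 / norm x) ^ Suc n) * (\<integral>\<^sup>+s\<in>{0<..}. h (s *\<^sub>R sgn x) * ennreal (s ^ n) \<partial>lborel)"
    if [measurable]: "h \<in> borel_measurable borel" and "x \<noteq> 0" for h :: "'a \<Rightarrow> ennreal" and x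
  proof -
    have "(\<integral>\<^sup>+t\<in>{0<..}. h (t *\<^sub>R x) * ennreal (t ^ n) \<partial>lborel)
        = ennreal (1 / norm x) * (\<integral>\<^sup>+s. h (((1 / norm x) * s) *\<^sub>R x) * ennreal (((1 / norm x) * s) ^ n) * indicator {0<..} ((1 / norm x) * s) \<partial>lborel)"
      using \<open>x \<noteq> 0\<close> by (subst nn_integral_real_affine[where c="1 / norm x" and t=0]) auto
    also have "(\<integral>\<^sup>+s. h (((1 / norm x) * s) *\<^sub>R x) * ennreal (((1 / norm x) * s) ^ n) * indicator {0<..} ((1 / norm x) * s) \<partial>lborel)
       = (\<integral>\<^sup>+s. ennreal ((1 / norm x) ^ n) * (h (s *\<^sub>R sgn x) * ennreal (s ^ n) * indicator {0<..} s) \<partial>lborel)"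
    proof (rule nn_integral_cong)
      fix s :: real
      show "h (((1 / norm x) * s) *\<^sub>R x) * ennreal (((1 / norm x) * s) ^ n) * indicator {0<..} ((1 / norm x) * s)
        = ennreal ((1 / norm x) ^ n) * (h (s *\<^sub>R sgn x) * ennreal (s ^ n) * indicator {0<..} s)"
      proof (cases "s > 0")
        case True
        have "(1 / norm x * s) *\<^sub>R x = s *\<^sub>R sgn x" by (simp add: sgn_div_norm divide_inverse mult.commute)
        then show ?thesis using True \<open>x \<noteq> 0\<close>
          by (subst power_mult_distrib) (simp add: ennreal_mult' mult_ac)
      qed (use \<open>x \<noteq> 0\<close> in \<open>auto simp: indicator_def zero_less_divide_iff zero_less_mult_iff\<close>)
    qed
    also have "\<dots> = ennreal ((1 / norm x) ^ n) * (\<integral>\<^sup>+s\<in>{0<..}. h (s *\<^sub>R sgn x) * ennreal (s ^ n) \<partial>lborel)"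
      by (rule nn_integral_cmult) simp
    finally show ?thesis by (simp only: power_Suc ennreal_mult zero_le_power zero_le_divide_1_iff norm_ge_zero mult.assoc)
  qed
  have "ennreal (ln 2) * (\<integral>\<^sup>+x. h1 x \<partial>lborel) \<le> ennreal (ln 2) * (\<integral>\<^sup>+x. h2 x \<partial>lborel)"
    unfolding nn_integral_rays[symmetric, OF assms(1)] nn_integral_rays[symmetric, OF assms(2)] n_def[symmetric]
  proof (rule nn_integral_mono)
    fix x :: 'a
    show "(\<integral>\<^sup>+t\<in>{0<..}. h1 (t *\<^sub>R x) * ennreal (t ^ n) \<partial>lborel) * indicator {x. 1 \<le> norm x \<and> norm x \<le> 2} x
        \<le> (\<integral>\<^sup>+t\<in>{0<..}. h2 (t *\<^sub>R x) * ennreal (t ^ n) \<partial>lborel) * indicator {x. 1 \<le> norm x \<and> norm x \<le> 2} x"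
    proof (cases "x = 0")
      case False
      then show ?thesis
        unfolding unit[OF assms(1) False] unit[OF assms(2) False]
        by (intro mult_right_mono mult_left_mono le[folded n_def]) (auto simp: norm_sgn)
    qed auto
  qed
  then show ?thesis
    by (subst (asm) ennreal_mult_le_mult_iff) auto
qed

subsection \<open>The Poincare inequality on convex sets\<close>

text \<open>For \<open>t \<ge> 1/2\<close> and fixed \<open>x\<close>, the contraction
  \<open>y\<close> to \<open>x + t *\<^sub>R (y - x)\<close> maps \<open>S\<close> into itself by
  convexity, and undoing it costs a Jacobian of at most \<open>2 ^ DIM('a)\<close>. For
  \<open>t < 1/2\<close> the roles of \<open>x\<close> and \<open>y\<close> are exchanged, which
  avoids the blow-up of the Jacobian as \<open>t\<close> tends to 0.\<close>

lemma nn_integral_convex_midsegment_le: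
  fixes S :: "'a::euclidean_space set" and g :: "'a \<Rightarrow> ennreal"
  assumes "convex S" and S[measurable]: "S \<in> sets borel" and [measurable]: "g \<in> borel_measurable borel"
    and t: "0 \<le> t" "t \<le> 1"
  shows "(\<integral>\<^sup>+x\<in>S. (\<integral>\<^sup>+y\<in>S. g (x + t *\<^sub>R (y - x)) \<partial>lborel) \<partial>lborel)
    \<le> ennreal (2 ^ DIM('a)) * emeasure lborel S * (\<integral>\<^sup>+z\<in>S. g z \<partial>lborel)"
proof -
  have half: "(\<integral>\<^sup>+x\<in>S. g (y + s *\<^sub>R (x - y)) \<partial>lborel) \<le> ennreal (2 ^ DIM('a)) * (\<integral>\<^sup>+z\<in>S. g z \<partial>lborel)"
    if "y \<in> S" and s: "1/2 \<le> s" "s \<le> 1" for y s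
  proof -
    have "1 / s \<le> 2" using s by (simp add: field_simps)
    have "(\<integral>\<^sup>+x\<in>S. g (y + s *\<^sub>R (x - y)) \<partial>lborel) \<le> (\<integral>\<^sup>+x. g ((1 - s) *\<^sub>R y + s *\<^sub>R x) * indicator S ((1 - s) *\<^sub>R y + s *\<^sub>R x) \<partial>lborel)"
    proof (rule nn_integral_mono)
      fix x
      have "y + s *\<^sub>R (x - y) = (1 - s) *\<^sub>R y + s *\<^sub>R x" by (simp add: algebra_simps)
      moreover have "x \<in> S \<Longrightarrow> (1 - s) *\<^sub>R y + s *\<^sub>R x \<in> S"
        using \<open>convex S\<close> \<open>y \<in> S\<close> s by (intro convexD) auto
      ultimately show "g (y + s *\<^sub>R (x - y)) * indicator S x \<le> g ((1 - s) *\<^sub>R y + s *\<^sub>R x) * indicator S ((1 - s) *\<^sub>R y + s *\<^sub>R x)"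
        by (auto simp: indicator_def)
    qed
    \<comment> \<open>A factor 1 is inserted so that the change of variables can be read from right
      to left.\<close>
    also have "\<dots> = ennreal ((1 / s) ^ DIM('a)) * (ennreal (s ^ DIM('a)) * (\<integral>\<^sup>+x. g ((1 - s) *\<^sub>R y + s *\<^sub>R x) * indicator S ((1 - s) *\<^sub>R y + s *\<^sub>R x) \<partial>lborel))"
      using s by (simp add: mult.assoc[symmetric] ennreal_mult[symmetric] power_mult_distrib[symmetric])
    also have "\<dots> = ennreal ((1 / s) ^ DIM('a)) * (\<integral>\<^sup>+z\<in>S. g z \<partial>lborel)"
      using s by (subst (2) nn_integral_affine[where c=s and t="(1 - s) *\<^sub>R y"]) auto
    also have "\<dots> \<le> ennreal (2 ^ DIM('a)) * (\<integral>\<^sup>+z\<in>S. g z \<partial>lborel)"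
      using s \<open>1 / s \<le> 2\<close> by (intro mult_right_mono ennreal_leI power_mono) auto
    finally show ?thesis .
  qed
  have avg: "(\<integral>\<^sup>+x\<in>S. f x \<partial>lborel) \<le> ennreal (2 ^ DIM('a)) * emeasure lborel S * (\<integral>\<^sup>+z\<in>S. g z \<partial>lborel)"
    if "\<And>x. x \<in> S \<Longrightarrow> f x \<le> ennreal (2 ^ DIM('a)) * (\<integral>\<^sup>+z\<in>S. g z \<partial>lborel)" for f
  proof -
    have "(\<integral>\<^sup>+x\<in>S. f x \<partial>lborel) \<le> (\<integral>\<^sup>+x. ennreal (2 ^ DIM('a)) * (\<integral>\<^sup>+z\<in>S. g z \<partial>lborel) * indicator S x \<partial>lborel)"
      using that by (intro nn_integral_mono) (auto simp: indicator_def)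
    also have "\<dots> = ennreal (2 ^ DIM('a)) * (\<integral>\<^sup>+z\<in>S. g z \<partial>lborel) * emeasure lborel S"
      by (rule nn_integral_cmult_indicator) simp
    finally show ?thesis by (simp add: mult_ac)
  qed
  show ?thesis
  proof (cases "t \<ge> 1/2")
    case True
    show ?thesis by (rule avg, rule half) (use True t in auto)
  next
    case False
    \<comment> \<open>The same point is a contraction towards \<open>y\<close> with factor
      \<open>1 - t > 1/2\<close>.\<close>
    have "(\<integral>\<^sup>+x\<in>S. (\<integral>\<^sup>+y\<in>S. g (x + t *\<^sub>R (y - x)) \<partial>lborel) \<partial>lborel)
      = (\<integral>\<^sup>+x. (\<integral>\<^sup>+y. g (y + (1 - t) *\<^sub>R (x - y)) * indicator S y * indicator S x \<partial>lborel) \<partial>lborel)"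
      by (subst nn_integral_multc[symmetric]) (auto simp: algebra_simps)
    also have "\<dots> = (\<integral>\<^sup>+y. (\<integral>\<^sup>+x. g (y + (1 - t) *\<^sub>R (x - y)) * indicator S y * indicator S x \<partial>lborel) \<partial>lborel)"
      by (rule lborel_pair.Fubini') measurable
    also have "\<dots> = (\<integral>\<^sup>+y\<in>S. (\<integral>\<^sup>+x\<in>S. g (y + (1 - t) *\<^sub>R (x - y)) \<partial>lborel) \<partial>lborel)"
      by (subst nn_integral_multc[symmetric]) (auto simp: mult_ac)
    also have "\<dots> \<le> ennreal (2 ^ DIM('a)) * emeasure lborel S * (\<integral>\<^sup>+z\<in>S. g z \<partial>lborel)"
      by (rule avg, rule half) (use False t in auto)
    finally show ?thesis .
  qed
qed

lemma GDERIV_along_line: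
  assumes "GDERIV u (x + t *\<^sub>R v) :> D"
  shows "((\<lambda>t. u (x + t *\<^sub>R v)) has_real_derivative (v \<bullet> D)) (at t)"
proof -
  have "((\<lambda>t. x + t *\<^sub>R v) has_derivative (\<lambda>h. h *\<^sub>R v)) (at t)"
    by (auto intro!: derivative_eq_intros)
  from has_derivative_compose[OF this, of u "\<lambda>h. h \<bullet> D"] assms
  show ?thesis by (simp add: gderiv_def has_field_derivative_def mult_commute_abs)
qed

text \<open>Cauchy-Schwarz along the segment, obtained from a square. With
  \<open>a = u y - u x\<close> and \<open>d\<close> the directional derivative,
  \<open>(d - a)\<^sup>2 \<ge> 0\<close> gives
  \<open>a\<^sup>2 \<le> d\<^sup>2 + (2 * a\<^sup>2 - 2 * a * d)\<close>, and the bracket is a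
  derivative with integral 0 over the unit interval.\<close>

lemma square_diff_le_segment_integral:
  fixes S :: "'a::euclidean_space set"
  assumes "convex S" "x \<in> S" "y \<in> S" "dist x y \<le> D" "continuous_on S G"
    and u: "\<And>x. x \<in> S \<Longrightarrow> GDERIV u x :> G x"
  shows "ennreal ((u x - u y)\<^sup>2)
    \<le> ennreal (D\<^sup>2) * (\<integral>\<^sup>+t\<in>{0..1}. ennreal ((norm (G (x + t *\<^sub>R (y - x))))\<^sup>2) \<partial>lborel)"
proof -
  define v where "v = y - x"
  define a where "a = u y - u x"
  have seg: "x + t *\<^sub>R v \<in> S" if "t \<in> {0..1}" for t
    using convexD_alt[OF assms(1,2,3), of t] that by (simp add: v_def algebra_simps)
  have "norm v \<le> D" using assms(4) by (simp add: v_def dist_norm norm_minus_commute)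
  have cont: "continuous_on {0..1} (\<lambda>t. G (x + t *\<^sub>R v))"
    by (rule continuous_on_compose2[OF \<open>continuous_on S G\<close>]) (use seg in \<open>auto intro!: continuous_intros\<close>)
  have "ennreal (a\<^sup>2) = (\<integral>\<^sup>+t\<in>{0..1::real}. ennreal (a\<^sup>2) \<partial>lborel)"
    by (subst nn_integral_cmult_indicator) auto
  also have "\<dots> \<le> (\<integral>\<^sup>+t\<in>{0..1}. ennreal (D\<^sup>2 * (norm (G (x + t *\<^sub>R v)))\<^sup>2) \<partial>lborel)"
  proof (rule nn_integral_Icc_mono_deriv[where F="\<lambda>t. 2 * a\<^sup>2 * t - 2 * a * u (x + t *\<^sub>R v)"])
    fix t :: real assume t: "t \<in> {0..1}"
    let ?d = "v \<bullet> G (x + t *\<^sub>R v)"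
    show "((\<lambda>t. 2 * a\<^sup>2 * t - 2 * a * u (x + t *\<^sub>R v)) has_real_derivative 2 * a\<^sup>2 - 2 * a * ?d) (at t)"
      by (rule derivative_eq_intros GDERIV_along_line[OF u] seg t refl | simp)+
    have "?d\<^sup>2 \<le> (norm v * norm (G (x + t *\<^sub>R v)))\<^sup>2"
      using Cauchy_Schwarz_ineq2 by (metis abs_le_square_iff abs_mult abs_norm_cancel)
    also have "\<dots> \<le> (D * norm (G (x + t *\<^sub>R v)))\<^sup>2"
      using \<open>norm v \<le> D\<close> by (intro power_mono mult_right_mono) auto
    finally have "?d\<^sup>2 \<le> D\<^sup>2 * (norm (G (x + t *\<^sub>R v)))\<^sup>2" by (simp add: power_mult_distrib)
    moreover have "(?d - a)\<^sup>2 \<ge> 0" by simp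
    ultimately show "a\<^sup>2 \<le> D\<^sup>2 * (norm (G (x + t *\<^sub>R v)))\<^sup>2 + (2 * a\<^sup>2 - 2 * a * ?d)"
      by (simp add: power2_eq_square algebra_simps)
  next
    show "2 * a\<^sup>2 * 1 - 2 * a * u (x + 1 *\<^sub>R v) \<le> 2 * a\<^sup>2 * 0 - 2 * a * u (x + 0 *\<^sub>R v)"
      by (simp add: a_def v_def power2_eq_square algebra_simps)
  qed (use cont in \<open>auto intro!: continuous_intros\<close>)
  \<comment> \<open>The integrand is only known to be continuous on \<open>{0..1}\<close>, so
    measurability is obtained for the function truncated by the indicator.\<close>
  also have "\<dots> = (\<integral>\<^sup>+t. ennreal (D\<^sup>2) * (ennreal (indicator {0..1} t *\<^sub>R (norm (G (x + t *\<^sub>R v)))\<^sup>2)) \<partial>lborel)"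
    by (intro nn_integral_cong) (auto simp: indicator_def ennreal_mult)
  also have "\<dots> = ennreal (D\<^sup>2) * (\<integral>\<^sup>+t. ennreal (indicator {0..1} t *\<^sub>R (norm (G (x + t *\<^sub>R v)))\<^sup>2) \<partial>lborel)"
  proof (rule nn_integral_cmult)
    have "(\<lambda>t. indicator {0..1} t *\<^sub>R (norm (G (x + t *\<^sub>R v)))\<^sup>2) \<in> borel_measurable borel"
      by (intro borel_measurable_continuous_on_indicator continuous_intros cont) simp
    then show "(\<lambda>t. ennreal (indicator {0..1} t *\<^sub>R (norm (G (x + t *\<^sub>R v)))\<^sup>2)) \<in> borel_measurable lborel"
      by (simp del: real_scaleR_def)
  qed
  also have "(\<integral>\<^sup>+t. ennreal (indicator {0..1} t *\<^sub>R (norm (G (x + t *\<^sub>R v)))\<^sup>2) \<partial>lborel)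
      = (\<integral>\<^sup>+t\<in>{0..1}. ennreal ((norm (G (x + t *\<^sub>R v)))\<^sup>2) \<partial>lborel)"
    by (intro nn_integral_cong) (auto simp: indicator_def)
  finally show ?thesis by (simp add: a_def v_def power2_commute)
qed

text \<open>The bound along segments is integrated over both endpoints, Tonelli moves the segment
  parameter outside, and for each parameter the midsegment estimate applies. The double integral, in
  place of a mean value of \<open>u\<close>, suits the later averaging over
  \<open>y\<close>.\<close>

lemma Poincare_convex:
  fixes S :: "'a::euclidean_space set"
  assumes "convex S" and S[measurable]: "S \<in> sets borel" and G[measurable]: "G \<in> borel_measurable borel"
    and D: "\<And>x y. x \<in> S \<Longrightarrow> y \<in> S \<Longrightarrow> dist x y \<le> D" and "continuous_on S G"
    and u: "\<And>x. x \<in> S \<Longrightarrow> GDERIV u x :> G x"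
  shows "(\<integral>\<^sup>+y\<in>S. (\<integral>\<^sup>+x\<in>S. ennreal ((u x - u y)\<^sup>2) \<partial>lborel) \<partial>lborel)
    \<le> ennreal (D\<^sup>2) * ennreal (2 ^ DIM('a)) * emeasure lborel S * (\<integral>\<^sup>+x\<in>S. ennreal ((norm (G x))\<^sup>2) \<partial>lborel)"
proof -
  let ?g = "\<lambda>x. ennreal ((norm (G x))\<^sup>2)"
  let ?h = "\<lambda>y x t. ?g (y + t *\<^sub>R (x - y)) * indicator {0..1} t * indicator S x * indicator S y"
  have "(\<integral>\<^sup>+y\<in>S. (\<integral>\<^sup>+x\<in>S. ennreal ((u x - u y)\<^sup>2) \<partial>lborel) \<partial>lborel)
     \<le> (\<integral>\<^sup>+y\<in>S. (\<integral>\<^sup>+x\<in>S. ennreal (D\<^sup>2) * (\<integral>\<^sup>+t\<in>{0..1}. ?g (y + t *\<^sub>R (x - y)) \<partial>lborel) \<partial>lborel) \<partial>lborel)"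
    using square_diff_le_segment_integral[OF assms(1) _ _ D assms(5) u]
    by (intro nn_integral_mono) (auto simp: indicator_def power2_commute intro!: nn_integral_mono)
  also have "\<dots> = ennreal (D\<^sup>2) * (\<integral>\<^sup>+y. \<integral>\<^sup>+x. \<integral>\<^sup>+t. ?h y x t \<partial>lborel \<partial>lborel \<partial>lborel)"
    by (simp add: nn_integral_cmult[symmetric] nn_integral_multc[symmetric] mult_ac)
  also have "(\<integral>\<^sup>+y. \<integral>\<^sup>+x. \<integral>\<^sup>+t. ?h y x t \<partial>lborel \<partial>lborel \<partial>lborel) = (\<integral>\<^sup>+y. \<integral>\<^sup>+t. \<integral>\<^sup>+x. ?h y x t \<partial>lborel \<partial>lborel \<partial>lborel)"
    by (intro nn_integral_cong lborel_pair.Fubini'[symmetric]) measurable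
  also have "\<dots> = (\<integral>\<^sup>+t. \<integral>\<^sup>+y. \<integral>\<^sup>+x. ?h y x t \<partial>lborel \<partial>lborel \<partial>lborel)"
    by (intro lborel_pair.Fubini'[symmetric]) measurable
  also have "\<dots> = (\<integral>\<^sup>+t. \<integral>\<^sup>+y. \<integral>\<^sup>+x. ?g (y + t *\<^sub>R (x - y)) * indicator S x * indicator S y * indicator {0..1} t \<partial>lborel \<partial>lborel \<partial>lborel)"
    by (simp add: mult_ac)
  also have "\<dots> = (\<integral>\<^sup>+t\<in>{0..1}. (\<integral>\<^sup>+y\<in>S. (\<integral>\<^sup>+x\<in>S. ?g (y + t *\<^sub>R (x - y)) \<partial>lborel) \<partial>lborel) \<partial>lborel)"
    by (simp add: nn_integral_multc)
  also have "\<dots> \<le> (\<integral>\<^sup>+t. (ennreal (2 ^ DIM('a)) * emeasure lborel S * (\<integral>\<^sup>+z\<in>S. ?g z \<partial>lborel)) * indicator {0..1::real} t \<partial>lborel)"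
    using nn_integral_convex_midsegment_le[OF assms(1) S, of ?g]
    by (intro nn_integral_mono) (auto simp: indicator_def)
  also have "\<dots> = ennreal (2 ^ DIM('a)) * emeasure lborel S * (\<integral>\<^sup>+z\<in>S. ?g z \<partial>lborel)"
    by (subst nn_integral_cmult_indicator) auto
  finally show ?thesis by (simp add: mult.assoc mult_left_mono)
qed

subsection \<open>The radial Lyapunov inequality\<close>

text \<open>Version for an endpoint where the integrands may blow up, as the conformal factor does
  at the boundary of the ball: monotone convergence over compact subintervals. The bound
  \<open>F t \<le> F a\<close> at every \<open>t\<close> takes the place of a boundary value at
  \<open>b\<close>.\<close>

lemma nn_integral_Ico_mono_deriv:
  fixes F P Q :: "real \<Rightarrow> real"
  assumes "a < b" "continuous_on {a..<b} P" "continuous_on {a..<b} Q"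
    and "\<And>t. t \<in> {a..<b} \<Longrightarrow> 0 \<le> P t" "\<And>t. t \<in> {a..<b} \<Longrightarrow> 0 \<le> Q t"
    and F: "\<And>t. t \<in> {a..<b} \<Longrightarrow> (F has_real_derivative F' t) (at t)"
    and "\<And>t. t \<in> {a..<b} \<Longrightarrow> P t \<le> Q t + F' t" "\<And>t. t \<in> {a..<b} \<Longrightarrow> F t \<le> F a"
  shows "(\<integral>\<^sup>+t\<in>{a..<b}. ennreal (P t) \<partial>lborel) \<le> (\<integral>\<^sup>+t\<in>{a..<b}. ennreal (Q t) \<partial>lborel)"
proof -
  \<comment> \<open>Since \<open>c 0 = a\<close>, every \<open>{a..c i}\<close> is a nonempty
    interval to which the compact version applies.\<close>
  define c where "c i = b - (b - a) / real (Suc i)" for i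
  have c: "a \<le> c i" "c i < b" for i
    using \<open>a < b\<close> mult_left_mono[of 1 "real (Suc i)" "b - a"] by (auto simp: c_def field_simps)
  have "incseq c"
    using \<open>a < b\<close> by (auto simp: incseq_def c_def intro!: divide_left_mono)
  have "(\<lambda>i. b - (b - a) * inverse (real (Suc i))) \<longlonglongrightarrow> b - (b - a) * 0"
    by (intro tendsto_intros LIMSEQ_inverse_real_of_nat)
  then have "c \<longlonglongrightarrow> b"
    by (simp add: c_def[abs_def] divide_inverse)
  have meas: "(\<lambda>t. ennreal (P t) * indicator {a..c i} t) \<in> borel_measurable lborel" for i
  proof -
    have "(\<lambda>t. indicator {a..c i} t *\<^sub>R P t) \<in> borel_measurable borel"
      using assms(2) c[of i] by (intro borel_measurable_continuous_on_indicator) (auto elim: continuous_on_subset)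
    then have "(\<lambda>t. ennreal (indicator {a..c i} t *\<^sub>R P t)) \<in> borel_measurable lborel" by simp
    also have "(\<lambda>t. ennreal (indicator {a..c i} t *\<^sub>R P t)) = (\<lambda>t. ennreal (P t) * indicator {a..c i} t)"
      by (auto simp: indicator_def)
    finally show ?thesis .
  qed
  have "(\<lambda>i. \<integral>\<^sup>+t\<in>{a..c i}. ennreal (P t) \<partial>lborel) \<longlonglongrightarrow> (\<integral>\<^sup>+t\<in>{a..<b}. ennreal (P t) \<partial>lborel)"
  proof (rule nn_integral_LIMSEQ[OF _ meas])
    show "incseq (\<lambda>i t. ennreal (P t) * indicator {a..c i} t)"
      using \<open>incseq c\<close> by (auto simp: incseq_def le_fun_def indicator_def intro: order_trans)
  next
    fix t
    show "(\<lambda>i. ennreal (P t) * indicator {a..c i} t) \<longlonglongrightarrow> ennreal (P t) * indicator {a..<b} t"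
    proof (cases "t < b")
      case True
      with \<open>c \<longlonglongrightarrow> b\<close> have "eventually (\<lambda>i. t < c i) sequentially" by (rule order_tendstoD)
      then have "eventually (\<lambda>i. ennreal (P t) * indicator {a..c i} t = ennreal (P t) * indicator {a..<b} t) sequentially"
        by eventually_elim (use True in \<open>auto simp: indicator_def\<close>)
      then show ?thesis by (rule tendsto_eventually)
    next
      case False
      then have "\<not> t \<le> c i" for i using c(2)[of i] by simp
      with False show ?thesis by simp
    qed
  qed
  then show ?thesis
  proof (rule LIMSEQ_le_const2, intro exI allI impI)
    fix i
    have sub: "{a..c i} \<subseteq> {a..<b}" using c[of i] by auto
    have "(\<integral>\<^sup>+t\<in>{a..c i}. ennreal (P t) \<partial>lborel) \<le> (\<integral>\<^sup>+t\<in>{a..c i}. ennreal (Q t) \<partial>lborel)"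
      by (rule nn_integral_Icc_mono_deriv[where F=F and F'=F'])
        (use assms c[of i] sub in \<open>auto intro: continuous_on_subset\<close>)
    also have "\<dots> \<le> (\<integral>\<^sup>+t\<in>{a..<b}. ennreal (Q t) \<partial>lborel)"
      using sub by (intro nn_integral_mono) (auto simp: indicator_def)
    finally show "(\<integral>\<^sup>+t\<in>{a..c i}. ennreal (P t) \<partial>lborel) \<le> (\<integral>\<^sup>+t\<in>{a..<b}. ennreal (Q t) \<partial>lborel)" .
  qed
qed

text \<open>The estimate along one ray, in the Euclidean radius
  \<open>s = tanh (\<rho> / 2)\<close>, with \<open>n = N - 1\<close>. Since
  \<open>q s * s = sinh \<rho>\<close>, the weight \<open>w s\<close> is
  \<open>exp (- \<tau>\<^sup>2) * sinh \<rho> ^ n * q s\<close>. The positive and negative parts of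
  \<open>\<tau>\<^sup>2 - C\<close> stand on different sides so that both integrands are
  nonnegative.\<close>

lemma radial_Lyapunov:
  fixes \<phi> \<phi>' :: "real \<Rightarrow> real" and n :: nat and l \<beta> :: real
  assumes l: "0 < l" "l \<le> \<beta>"
    and \<phi>: "\<And>s. s \<in> {0..<1} \<Longrightarrow> (\<phi> has_real_derivative \<phi>' s) (at s)"
    and \<phi>': "continuous_on {0..<1} \<phi>'"
  defines "\<rho> \<equiv> \<lambda>s. ln ((1 + s) / (1 - s))" and "q \<equiv> \<lambda>s. 2 / (1 - s\<^sup>2)"
  defines "w \<equiv> \<lambda>s. exp (- ((\<rho> s)\<^sup>2 / l\<^sup>2)) * q s ^ Suc n * s ^ n"
    and "C \<equiv> real (Suc n) + (n * \<beta>)\<^sup>2 / 2"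
  shows "(\<integral>\<^sup>+s\<in>{0..<1}. ennreal (max ((\<rho> s / l)\<^sup>2 - C) 0 * (\<phi> s)\<^sup>2 * w s) \<partial>lborel)
    \<le> (\<integral>\<^sup>+s\<in>{0..<1}. ennreal ((2 * l\<^sup>2 * (\<phi>' s / q s)\<^sup>2 + max (C - (\<rho> s / l)\<^sup>2) 0 * (\<phi> s)\<^sup>2) * w s) \<partial>lborel)"
proof -
  define E where "E s = exp (- ((\<rho> s)\<^sup>2 / l\<^sup>2))" for s
  \<comment> \<open>In hyperbolic terms \<open>V\<close> is
    \<open>\<rho> * exp (- \<tau>\<^sup>2) * sinh \<rho> ^ n\<close>; the last factor in
    \<open>V'\<close> is the derivative \<open>q s * cosh \<rho>\<close> of
    \<open>sinh \<rho>\<close> with respect to \<open>s\<close>.\<close>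
  define V where "V s = \<rho> s * E s * (q s * s) ^ n" for s
  define V' where "V' s = E s * (q s * (q s * s) ^ n * (1 - 2 * (\<rho> s / l)\<^sup>2)
      + \<rho> s * (n * (q s * s) ^ (n - 1) * (2 * (1 + s\<^sup>2) / (1 - s\<^sup>2)\<^sup>2)))" for s
  have sq: "1 - s\<^sup>2 > 0" if "s \<in> {0..<1}" for s :: real
    using that by (simp add: power_less_one_iff abs_square_less_1)
  \<comment> \<open>As \<open>coth \<rho> = (1 + s\<^sup>2) / (2 * s)\<close> for
    \<open>s > 0\<close>, the second claim is \<open>\<rho> * coth \<rho> \<le> 1 + \<rho>\<close>
    with denominators cleared. It follows from \<open>ln x \<le> x - 1\<close>.\<close>
  have \<rho>0: "0 \<le> \<rho> s" and \<rho>1: "\<rho> s * (1 - s)\<^sup>2 \<le> 2 * s" if "s \<in> {0..<1}" for s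
  proof -
    show "0 \<le> \<rho> s" using that by (auto simp: \<rho>_def)
    have "\<rho> s \<le> (1 + s) / (1 - s) - 1" unfolding \<rho>_def using that by (intro ln_le_minus_one) auto
    also have "\<dots> = 2 * s / (1 - s)" using that by (auto simp: field_simps)
    finally have "\<rho> s * (1 - s) \<le> 2 * s" using that by (simp add: field_simps)
    then have "\<rho> s * (1 - s) * (1 - s) \<le> 2 * s * (1 - s)" using that by (intro mult_right_mono) auto
    also have "\<dots> \<le> 2 * s" using that by (simp add: algebra_simps)
    finally show "\<rho> s * (1 - s)\<^sup>2 \<le> 2 * s" by (simp add: power2_eq_square mult.assoc)
  qed
  have q0: "q s > 0" if "s \<in> {0..<1}" for s using sq[OF that] by (simp add: q_def)
  have d\<rho>: "(\<rho> has_real_derivative q s) (at s)" if "s \<in> {0..<1}" for s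
  proof -
    have "(\<rho> has_real_derivative ((1 * (1 - s) - (1 + s) * (0 - 1)) / ((1 - s) * (1 - s))) / ((1 + s) / (1 - s))) (at s)"
      unfolding \<rho>_def by (rule derivative_eq_intros refl | use that in \<open>simp add: divide_inverse\<close>)+
    also have "((1 * (1 - s) - (1 + s) * (0 - 1)) / ((1 - s) * (1 - s))) / ((1 + s) / (1 - s)) = q s"
      using that sq[OF that] by (simp add: q_def divide_simps power2_eq_square) (simp add: algebra_simps)
    finally show ?thesis .
  qed
  have dq: "((\<lambda>s. q s * s) has_real_derivative 2 * (1 + s\<^sup>2) / (1 - s\<^sup>2)\<^sup>2) (at s)" if "s \<in> {0..<1}" for s
    unfolding q_def using sq[OF that]
    by (auto intro!: derivative_eq_intros simp: divide_simps power2_eq_square)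
  have dV: "(V has_real_derivative V' s) (at s)" if "s \<in> {0..<1}" for s
  proof -
    have "(E has_real_derivative E s * (- (2 * \<rho> s * q s / l\<^sup>2))) (at s)"
      unfolding E_def[abs_def] using l by (auto intro!: derivative_eq_intros d\<rho>[OF that] simp: divide_simps power2_eq_square power4_eq_xxxx)
    from DERIV_mult[OF DERIV_mult[OF d\<rho>[OF that] this] DERIV_power[OF dq[OF that], of n]]
    show ?thesis
      unfolding V_def[abs_def]
      by (rule DERIV_cong) (use l in \<open>simp add: V'_def power_divide field_simps power2_eq_square\<close>)
  qed
  \<comment> \<open>The derivative of the Gaussian yields \<open>- 2 * \<tau>\<^sup>2\<close>. The
    term \<open>n * \<rho> \<le> (n * \<beta>) * \<tau>\<close> consumes half a
    \<open>\<tau>\<^sup>2\<close> by Young's inequality, which also produces the summand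
    \<open>(n * \<beta>)\<^sup>2 / 2\<close> of \<open>C\<close>.\<close>
  have V'_le: "V' s \<le> w s * (C - 3 / 2 * (\<rho> s / l)\<^sup>2)" if s: "s \<in> {0..<1}" for s
  proof -
    let ?\<tau> = "\<rho> s / l"
    have "\<rho> s * (n * (q s * s) ^ (n - 1) * (2 * (1 + s\<^sup>2) / (1 - s\<^sup>2)\<^sup>2)) \<le> n * (1 + \<rho> s) * (q s * (q s * s) ^ n)"
    proof (cases n)
      case (Suc k)
      have "\<rho> s * (2 + 2 * s\<^sup>2) \<le> (1 + \<rho> s) * (4 * s)"
        using \<rho>1[OF s] by (simp add: power2_eq_square algebra_simps)
      then have "\<rho> s * (2 * (1 + s\<^sup>2) / (1 - s\<^sup>2)\<^sup>2) \<le> (1 + \<rho> s) * (q s * (q s * s))"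
        using sq[OF s] by (simp add: q_def divide_simps power2_eq_square)
      then have "(n * (q s * s) ^ k) * (\<rho> s * (2 * (1 + s\<^sup>2) / (1 - s\<^sup>2)\<^sup>2)) \<le> (n * (q s * s) ^ k) * ((1 + \<rho> s) * (q s * (q s * s)))"
        using s q0[OF s] by (intro mult_left_mono) auto
      then show ?thesis unfolding Suc by (simp add: mult_ac)
    qed simp
    also have "\<dots> \<le> (C - 1 + ?\<tau>\<^sup>2 / 2) * (q s * (q s * s) ^ n)"
    proof (intro mult_right_mono)
      have "\<rho> s = l * ?\<tau>" using l by simp
      also have "\<dots> \<le> \<beta> * ?\<tau>" using l \<rho>0[OF s] by (intro mult_right_mono) auto
      finally have "n * \<rho> s \<le> (n * \<beta>) * ?\<tau>" by (metis mult_left_mono of_nat_0_le_iff mult.assoc)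
      also have "\<dots> \<le> (n * \<beta>)\<^sup>2 / 2 + ?\<tau>\<^sup>2 / 2"
        using sum_squares_bound[of "n * \<beta>" ?\<tau>] by simp
      finally show "n * (1 + \<rho> s) \<le> C - 1 + ?\<tau>\<^sup>2 / 2" by (simp add: C_def algebra_simps)
    qed (use s q0[OF s] in auto)
    finally have "V' s \<le> E s * (q s * (q s * s) ^ n * (1 - 2 * ?\<tau>\<^sup>2) + (C - 1 + ?\<tau>\<^sup>2 / 2) * (q s * (q s * s) ^ n))"
      unfolding V'_def by (intro mult_left_mono add_left_mono) (auto simp: E_def)
    also have "\<dots> = w s * (C - 3 / 2 * ?\<tau>\<^sup>2)"
      by (simp add: w_def E_def power_mult_distrib algebra_simps)
    finally show ?thesis .
  qed
  have w0: "w s \<ge> 0" if "s \<in> {0..<1}" for s using that q0[OF that] by (simp add: w_def)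
  have cont: "continuous_on {0..<1} \<phi>" "continuous_on {0..<1} \<rho>"
    by (rule DERIV_continuous_on[OF has_field_derivative_at_within[OF \<phi>]], assumption)
      (rule DERIV_continuous_on[OF has_field_derivative_at_within[OF d\<rho>]])
  have contq: "continuous_on {0..<1} q" unfolding q_def using sq by (intro continuous_intros) force
  have contw: "continuous_on {0..<1} w" unfolding w_def using l by (intro continuous_intros cont contq) auto
  show ?thesis
  proof (rule nn_integral_Ico_mono_deriv[where F="\<lambda>s. - ((\<phi> s)\<^sup>2 * V s)"])
    fix s :: real assume s: "s \<in> {0..<1}"
    show "((\<lambda>s. - ((\<phi> s)\<^sup>2 * V s)) has_real_derivative - (2 * \<phi> s * \<phi>' s * V s + (\<phi> s)\<^sup>2 * V' s)) (at s)"
      by (auto intro!: derivative_eq_intros \<phi>[OF s] dV[OF s])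
    \<comment> \<open>The value at 0 vanishes because \<open>\<rho> 0 = 0\<close>, and
      \<open>V\<close> is nonnegative.\<close>
    show "- ((\<phi> s)\<^sup>2 * V s) \<le> - ((\<phi> 0)\<^sup>2 * V 0)"
      using s \<rho>0[OF s] q0[OF s] by (simp add: V_def E_def \<rho>_def)
    let ?\<tau> = "\<rho> s / l" and ?g = "\<phi>' s / q s"
    have V: "\<phi>' s * V s = ?g * (l * ?\<tau>) * w s"
      using q0[OF s] l by (simp add: V_def w_def E_def power_mult_distrib)
    \<comment> \<open>Young's inequality for the cross term, balanced so that it uses up only half a
      \<open>\<tau>\<^sup>2\<close>; the coefficient \<open>2 * l\<^sup>2\<close> of the energy
      comes from here.\<close>
    have "0 \<le> (\<phi> s * ?\<tau> - 2 * l * ?g)\<^sup>2 / 2" by simp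
    also have "\<dots> = (\<phi> s)\<^sup>2 * ?\<tau>\<^sup>2 / 2 + 2 * l\<^sup>2 * ?g\<^sup>2 - 2 * \<phi> s * (?g * (l * ?\<tau>))"
    proof -
      have "(p * t - 2 * l * g)\<^sup>2 / 2 = p\<^sup>2 * t\<^sup>2 / 2 + 2 * l\<^sup>2 * g\<^sup>2 - 2 * p * (g * (l * t))" for p t g :: real
        by (simp add: power2_eq_square field_simps)
      then show ?thesis .
    qed
    finally have "0 \<le> ((\<phi> s)\<^sup>2 * ?\<tau>\<^sup>2 / 2 + 2 * l\<^sup>2 * ?g\<^sup>2 - 2 * \<phi> s * (?g * (l * ?\<tau>))) * w s"
      using w0[OF s] by (intro mult_nonneg_nonneg)
    moreover have "(\<phi> s)\<^sup>2 * V' s \<le> (\<phi> s)\<^sup>2 * (w s * (C - 3 / 2 * ?\<tau>\<^sup>2))"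
      by (intro mult_left_mono V'_le s) auto
    moreover have "2 * \<phi> s * \<phi>' s * V s = 2 * \<phi> s * (?g * (l * ?\<tau>)) * w s"
      using V by (simp only: mult.assoc)
    moreover have "max (?\<tau>\<^sup>2 - C) 0 = (?\<tau>\<^sup>2 - C) + max (C - ?\<tau>\<^sup>2) 0" by simp
    \<comment> \<open>The bookkeeping for abstract reals: \<open>t\<close> is
      \<open>\<tau>\<^sup>2\<close>, \<open>V1\<close> and \<open>V2\<close> are the two parts of
      the derivative of \<open>\<phi>\<^sup>2 * V\<close>, and the coefficients 1/2 and -3/2 of
      \<open>\<tau>\<^sup>2\<close> add up to -1.\<close>
    moreover have "k * a * W \<le> (g + m * a) * W + - (V1 + V2)"
      if "0 \<le> (a * t / 2 + g - x) * W" "V2 \<le> a * (W * (C - 3 / 2 * t))" "V1 = x * W" "k = (t - C) + m"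
      for a t g x W V1 V2 k m :: real
      using that(1,2) unfolding that(3,4) by (simp add: algebra_simps)
    ultimately show "max (?\<tau>\<^sup>2 - C) 0 * (\<phi> s)\<^sup>2 * w s
        \<le> (2 * l\<^sup>2 * ?g\<^sup>2 + max (C - ?\<tau>\<^sup>2) 0 * (\<phi> s)\<^sup>2) * w s + - (2 * \<phi> s * \<phi>' s * V s + (\<phi> s)\<^sup>2 * V' s)"
      by blast
  next
    show "continuous_on {0..<1} (\<lambda>s. (2 * l\<^sup>2 * (\<phi>' s / q s)\<^sup>2 + max (C - (\<rho> s / l)\<^sup>2) 0 * (\<phi> s)\<^sup>2) * w s)"
      using q0 l by (intro continuous_intros cont contq contw \<phi>') force+
  qed (use w0 l in \<open>auto intro!: continuous_intros cont contw\<close>)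
qed

subsection \<open>The Lyapunov inequality on the hyperbolic space\<close>

lemma hyp_factor_ge_1: "x \<in> hyp_space \<Longrightarrow> 1 \<le> hyp_factor x"
  by (simp add: hyp_factor_def field_simps power_less_one_iff add_increasing2)

text \<open>Bounds the Euclidean diameter of a hyperbolic ball around 0 by twice its radius, the
  source of the factor \<open>l\<^sup>2\<close> in the local estimate.\<close>

lemma norm_le_hyp_rho:
  assumes "x \<in> hyp_space"
  shows "norm x \<le> hyp_rho x"
proof -
  have "ln (1 - norm x) \<le> - norm x"
    using assms ln_le_minus_one[of "1 - norm x"] by simp
  moreover have "0 \<le> ln (1 + norm x)" by simp
  moreover have "hyp_rho x = ln (1 + norm x) - ln (1 - norm x)"
    using assms by (simp add: hyp_rho_def ln_div add_pos_nonneg[THEN less_imp_neq, symmetric])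
  ultimately show ?thesis by linarith
qed

lemma exp_hyp_rho: "x \<in> hyp_space \<Longrightarrow> exp (hyp_rho x) = (1 + norm x) / (1 - norm x)"
  by (simp add: hyp_rho_def add_pos_nonneg)

lemma hyp_factor_le:
  assumes "x \<in> hyp_space"
  shows "hyp_factor x \<le> 1 + exp (hyp_rho x)"
proof -
  have "(norm x)\<^sup>2 \<le> norm x"
    using assms by (simp add: power2_eq_square mult_left_le)
  then have "hyp_factor x \<le> 2 / (1 - norm x)"
    unfolding hyp_factor_def using assms by (intro divide_left_mono mult_pos_pos) auto
  also have "\<dots> = 1 + exp (hyp_rho x)"
    using assms by (simp add: exp_hyp_rho field_simps)
  finally show ?thesis .
qed

text \<open>Hyperbolic balls around the origin are Euclidean balls, of radius
  \<open>tanh (a / 2)\<close>. This makes them convex, as the Euclidean Poincare inequality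
  requires; for \<open>a \<le> 0\<close> both sides are empty.\<close>

lemma hyp_rho_ball: "{x \<in> hyp_space. hyp_rho x < a} = ball 0 ((exp a - 1) / (exp a + 1))"
proof -
  have "x \<in> hyp_space \<and> hyp_rho x < a \<longleftrightarrow> norm x < (exp a - 1) / (exp a + 1)" for x :: 'a
  proof (cases "norm x < 1")
    case True
    then have "hyp_rho x < a \<longleftrightarrow> (1 + norm x) / (1 - norm x) < exp a"
      by (subst exp_less_cancel_iff[symmetric]) (simp add: exp_hyp_rho)
    also have "\<dots> \<longleftrightarrow> norm x * (exp a + 1) < exp a - 1"
      using True by (simp add: pos_divide_less_eq algebra_simps)
    also have "\<dots> \<longleftrightarrow> norm x < (exp a - 1) / (exp a + 1)"
      by (simp add: pos_less_divide_eq add_pos_pos)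
    finally show ?thesis using True by simp
  next
    case False
    have "0 < exp a + 1" by (simp add: add_pos_pos)
    then have "(exp a - 1) / (exp a + 1) \<le> 1" by (simp add: divide_le_eq)
    with False show ?thesis by simp
  qed
  then show ?thesis by auto
qed

lemma sets_hyp_space [measurable]: "hyp_space \<in> sets borel"
  by simp

lemma borel_measurable_hyp_rho [measurable]: "hyp_rho \<in> borel_measurable borel"
  unfolding hyp_rho_def[abs_def] by measurable

lemma borel_measurable_hyp_factor [measurable]: "hyp_factor \<in> borel_measurable borel"
  unfolding hyp_factor_def[abs_def] by measurable

text \<open>The density of \<mu> with respect to Lebesgue measure, so that the rays and Tonelli for
  \<open>lborel\<close> are available.\<close>

definition hyp_gaussian :: "real \<Rightarrow> 'a::euclidean_space \<Rightarrow> real" where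
  "hyp_gaussian l x = exp (- ((hyp_rho x)\<^sup>2 / l\<^sup>2)) * hyp_factor x ^ DIM('a)"

lemma borel_measurable_hyp_gaussian [measurable]: "hyp_gaussian l \<in> borel_measurable borel"
  unfolding hyp_gaussian_def[abs_def] by measurable

lemma hyp_gaussian_nonneg: "x \<in> hyp_space \<Longrightarrow> 0 \<le> hyp_gaussian l x"
  using hyp_factor_ge_1[of x] by (simp add: hyp_gaussian_def)

text \<open>The radial estimate holds in every direction, and the radial derivative is at most
  \<open>norm (G x)\<close> by Cauchy-Schwarz. The quotient \<open>norm (G x) / hyp_factor x\<close>
  is the Riemannian norm of the gradient.\<close>

lemma hyp_Lyapunov:
  fixes u :: "'a::euclidean_space \<Rightarrow> real"
  assumes [measurable]: "u \<in> borel_measurable borel" "G \<in> borel_measurable borel"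
    and G: "continuous_on hyp_space G" "\<And>x. x \<in> hyp_space \<Longrightarrow> GDERIV u x :> G x"
    and l: "0 < l" "l \<le> \<beta>"
  defines "C \<equiv> real DIM('a) + (real (DIM('a) - 1) * \<beta>)\<^sup>2 / 2"
  shows "(\<integral>\<^sup>+x\<in>hyp_space. ennreal (max ((hyp_rho x / l)\<^sup>2 - C) 0 * (u x)\<^sup>2 * hyp_gaussian l x) \<partial>lborel)
    \<le> (\<integral>\<^sup>+x\<in>hyp_space. ennreal ((2 * l\<^sup>2 * (norm (G x) / hyp_factor x)\<^sup>2
          + max (C - (hyp_rho x / l)\<^sup>2) 0 * (u x)\<^sup>2) * hyp_gaussian l x) \<partial>lborel)"
proof (rule nn_integral_mono_rays)
  fix w :: 'a assume w: "norm w = 1"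
  define n where "n = DIM('a) - 1"
  have n: "DIM('a) = Suc n" by (simp add: n_def)
  define \<rho> where "\<rho> s = ln ((1 + s) / (1 - s))" for s :: real
  define q where "q s = 2 / (1 - s\<^sup>2)" for s :: real
  define W where "W s = exp (- ((\<rho> s)\<^sup>2 / l\<^sup>2)) * q s ^ Suc n * s ^ n" for s
  have ray: "hyp_rho (s *\<^sub>R w) = \<rho> s" "hyp_factor (s *\<^sub>R w) = q s"
    "hyp_gaussian l (s *\<^sub>R w) * s ^ n = W s" if "0 < s" for s
    using w that by (simp_all add: hyp_rho_def hyp_factor_def \<rho>_def q_def hyp_gaussian_def W_def n)
  \<comment> \<open>The polar weight \<open>s ^ n\<close> is absorbed into \<open>W\<close>, and the
    unit ball restricts the ray to \<open>{0<..<1}\<close>.\<close>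
  have ray_eq: "ennreal (A * hyp_gaussian l (s *\<^sub>R w)) * indicator hyp_space (s *\<^sub>R w) * ennreal (s ^ n) * indicator {0<..} s
      = ennreal (A * W s) * indicator {0<..<1} s" for A s
  proof (cases "s > 0")
    case True
    then show ?thesis using w
      by (auto simp: indicator_def ray(3)[OF True, symmetric] ennreal_mult''[symmetric] mult.assoc)
  qed auto
  \<comment> \<open>The rays omit \<open>s = 0\<close>, while the radial estimate starts there to
    make the boundary term vanish; the difference is a null set.\<close>
  have strip: "(\<integral>\<^sup>+s. f s * indicator {0<..<1} s \<partial>lborel) = (\<integral>\<^sup>+s\<in>{0..<1::real}. f s \<partial>lborel)" for f
    by (rule nn_integral_cong_AE, rule AE_mp[OF AE_lborel_singleton[of 0]]) (auto simp: indicator_def)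
  have "(\<integral>\<^sup>+s. ennreal (max ((hyp_rho (s *\<^sub>R w) / l)\<^sup>2 - C) 0 * (u (s *\<^sub>R w))\<^sup>2 * hyp_gaussian l (s *\<^sub>R w))
          * indicator hyp_space (s *\<^sub>R w) * ennreal (s ^ n) * indicator {0<..} s \<partial>lborel)
      = (\<integral>\<^sup>+s. ennreal (max ((\<rho> s / l)\<^sup>2 - C) 0 * (u (s *\<^sub>R w))\<^sup>2 * W s) * indicator {0<..<1} s \<partial>lborel)"
    unfolding ray_eq by (rule nn_integral_cong) (auto simp: indicator_def ray)
  also have "\<dots> = (\<integral>\<^sup>+s\<in>{0..<1}. ennreal (max ((\<rho> s / l)\<^sup>2 - C) 0 * (u (s *\<^sub>R w))\<^sup>2 * W s) \<partial>lborel)"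
    by (rule strip)
  also have "\<dots> \<le> (\<integral>\<^sup>+s\<in>{0..<1}. ennreal ((2 * l\<^sup>2 * ((w \<bullet> G (s *\<^sub>R w)) / q s)\<^sup>2
        + max (C - (\<rho> s / l)\<^sup>2) 0 * (u (s *\<^sub>R w))\<^sup>2) * W s) \<partial>lborel)"
    unfolding \<rho>_def q_def W_def C_def n diff_Suc_1
  proof (rule radial_Lyapunov[OF l])
    fix s :: real assume "s \<in> {0..<1}"
    then show "((\<lambda>s. u (s *\<^sub>R w)) has_real_derivative w \<bullet> G (s *\<^sub>R w)) (at s)"
      using GDERIV_along_line[of u 0 s w] G(2)[of "s *\<^sub>R w"] w by simp
  next
    show "continuous_on {0..<1} (\<lambda>s. w \<bullet> G (s *\<^sub>R w))"
      by (intro continuous_intros continuous_on_compose2[OF G(1)]) (use w in auto)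
  qed
  also have "\<dots> = (\<integral>\<^sup>+s. ennreal ((2 * l\<^sup>2 * ((w \<bullet> G (s *\<^sub>R w)) / q s)\<^sup>2
        + max (C - (\<rho> s / l)\<^sup>2) 0 * (u (s *\<^sub>R w))\<^sup>2) * W s) * indicator {0<..<1} s \<partial>lborel)"
    by (rule strip[symmetric])
  also have "\<dots> \<le> (\<integral>\<^sup>+s. ennreal ((2 * l\<^sup>2 * (norm (G (s *\<^sub>R w)) / hyp_factor (s *\<^sub>R w))\<^sup>2
        + max (C - (hyp_rho (s *\<^sub>R w) / l)\<^sup>2) 0 * (u (s *\<^sub>R w))\<^sup>2) * W s) * indicator {0<..<1} s \<partial>lborel)"
  proof (rule nn_integral_mono)
    fix s
    have "(w \<bullet> G (s *\<^sub>R w))\<^sup>2 \<le> (norm (G (s *\<^sub>R w)))\<^sup>2"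
      using Cauchy_Schwarz_ineq2[of w "G (s *\<^sub>R w)"] w by (simp add: abs_le_square_iff[symmetric])
    moreover have "0 \<le> W s" if "0 < s" "s < 1"
      using that by (auto simp: W_def q_def abs_square_le_1 intro!: mult_nonneg_nonneg)
    ultimately show "ennreal ((2 * l\<^sup>2 * ((w \<bullet> G (s *\<^sub>R w)) / q s)\<^sup>2
        + max (C - (\<rho> s / l)\<^sup>2) 0 * (u (s *\<^sub>R w))\<^sup>2) * W s) * indicator {0<..<1} s
      \<le> ennreal ((2 * l\<^sup>2 * (norm (G (s *\<^sub>R w)) / hyp_factor (s *\<^sub>R w))\<^sup>2
        + max (C - (hyp_rho (s *\<^sub>R w) / l)\<^sup>2) 0 * (u (s *\<^sub>R w))\<^sup>2) * W s) * indicator {0<..<1} s"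
      by (auto simp: indicator_def ray power_divide intro!: ennreal_leI mult_right_mono add_right_mono mult_left_mono divide_right_mono)
  qed
  also have "\<dots> = (\<integral>\<^sup>+s. ennreal ((2 * l\<^sup>2 * (norm (G (s *\<^sub>R w)) / hyp_factor (s *\<^sub>R w))\<^sup>2
        + max (C - (hyp_rho (s *\<^sub>R w) / l)\<^sup>2) 0 * (u (s *\<^sub>R w))\<^sup>2) * hyp_gaussian l (s *\<^sub>R w))
          * indicator hyp_space (s *\<^sub>R w) * ennreal (s ^ n) * indicator {0<..} s \<partial>lborel)"
    unfolding ray_eq ..
  finally show "(\<integral>\<^sup>+s. ennreal (max ((hyp_rho (s *\<^sub>R w) / l)\<^sup>2 - C) 0 * (u (s *\<^sub>R w))\<^sup>2 * hyp_gaussian l (s *\<^sub>R w))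
          * indicator hyp_space (s *\<^sub>R w) * ennreal (s ^ (DIM('a) - 1)) * indicator {0<..} s \<partial>lborel)
      \<le> (\<integral>\<^sup>+s. ennreal ((2 * l\<^sup>2 * (norm (G (s *\<^sub>R w)) / hyp_factor (s *\<^sub>R w))\<^sup>2
        + max (C - (hyp_rho (s *\<^sub>R w) / l)\<^sup>2) 0 * (u (s *\<^sub>R w))\<^sup>2) * hyp_gaussian l (s *\<^sub>R w))
          * indicator hyp_space (s *\<^sub>R w) * ennreal (s ^ (DIM('a) - 1)) * indicator {0<..} s \<partial>lborel)"
    unfolding n_def .
qed measurable

text \<open>Outside \<open>B\<close>, that is for \<open>\<tau>\<^sup>2 \<ge> 2 * C\<close>, the
  coefficient \<open>\<tau>\<^sup>2 - C\<close> is at least \<open>C\<close>, so the Lyapunov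
  inequality controls \<open>C * (u x)\<^sup>2\<close>. Inside \<open>B\<close> this term is kept,
  and a second copy of it bounds the negative part of \<open>\<tau>\<^sup>2 - C\<close>; hence the
  factor \<open>2 * C\<close>.\<close>

lemma hyp_L2_le_energy_plus_ball:
  fixes u :: "'a::euclidean_space \<Rightarrow> real"
  assumes [measurable]: "u \<in> borel_measurable borel" "G \<in> borel_measurable borel"
    and G: "continuous_on hyp_space G" "\<And>x. x \<in> hyp_space \<Longrightarrow> GDERIV u x :> G x"
    and l: "0 < l" "l \<le> \<beta>"
  defines "C \<equiv> real DIM('a) + (real (DIM('a) - 1) * \<beta>)\<^sup>2 / 2"
  defines "B \<equiv> {x \<in> hyp_space. hyp_rho x < sqrt (2 * C) * l}"
  shows "ennreal C * (\<integral>\<^sup>+x\<in>hyp_space. ennreal ((u x)\<^sup>2 * hyp_gaussian l x) \<partial>lborel)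
    \<le> ennreal (2 * l\<^sup>2) * (\<integral>\<^sup>+x\<in>hyp_space. ennreal ((norm (G x) / hyp_factor x)\<^sup>2 * hyp_gaussian l x) \<partial>lborel)
      + ennreal (2 * C) * (\<integral>\<^sup>+x\<in>B. ennreal ((u x)\<^sup>2 * hyp_gaussian l x) \<partial>lborel)"
proof -
  have [measurable]: "B \<in> sets borel" unfolding B_def hyp_rho_ball by simp
  have "C > 0" by (simp add: C_def add_pos_nonneg)
  let ?g = "hyp_gaussian l :: 'a \<Rightarrow> real"
  let ?b = "\<lambda>x. ennreal ((u x)\<^sup>2 * ?g x) * indicator B x"
  let ?e = "\<lambda>x. ennreal ((norm (G x) / hyp_factor x)\<^sup>2 * ?g x) * indicator hyp_space x"
  have B: "x \<in> B \<longleftrightarrow> (hyp_rho x / l)\<^sup>2 < 2 * C" if "x \<in> hyp_space" for x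
  proof -
    have "0 \<le> hyp_rho x / l" using order_trans[OF norm_ge_zero norm_le_hyp_rho[OF that]] l by simp
    then have "(hyp_rho x / l)\<^sup>2 < 2 * C \<longleftrightarrow> hyp_rho x / l < sqrt (2 * C)"
      using \<open>C > 0\<close> by (metis abs_of_nonneg real_sqrt_abs real_sqrt_less_iff)
    then show ?thesis using that l by (simp add: B_def field_simps)
  qed
  have "ennreal C * (\<integral>\<^sup>+x\<in>hyp_space. ennreal ((u x)\<^sup>2 * ?g x) \<partial>lborel)
      = (\<integral>\<^sup>+x. ennreal C * (ennreal ((u x)\<^sup>2 * ?g x) * indicator hyp_space x) \<partial>lborel)"
    by (rule nn_integral_cmult[symmetric]) measurable
  also have "\<dots> \<le> (\<integral>\<^sup>+x. ennreal (max ((hyp_rho x / l)\<^sup>2 - C) 0 * (u x)\<^sup>2 * ?g x) * indicator hyp_space x + ennreal C * ?b x \<partial>lborel)"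
  proof (rule nn_integral_mono)
    fix x :: 'a
    show "ennreal C * (ennreal ((u x)\<^sup>2 * ?g x) * indicator hyp_space x)
      \<le> ennreal (max ((hyp_rho x / l)\<^sup>2 - C) 0 * (u x)\<^sup>2 * ?g x) * indicator hyp_space x + ennreal C * ?b x"
    proof (cases "x \<in> hyp_space \<and> x \<notin> B")
      case True
      then have "C * ((u x)\<^sup>2 * ?g x) \<le> max ((hyp_rho x / l)\<^sup>2 - C) 0 * ((u x)\<^sup>2 * ?g x)"
        using B hyp_gaussian_nonneg[of x l] by (intro mult_right_mono) auto
      then show ?thesis using True \<open>C > 0\<close>
        by (simp add: ennreal_mult'[symmetric] ennreal_leI mult.assoc)
    qed (auto simp: indicator_def)
  qed
  also have "\<dots> = (\<integral>\<^sup>+x\<in>hyp_space. ennreal (max ((hyp_rho x / l)\<^sup>2 - C) 0 * (u x)\<^sup>2 * ?g x) \<partial>lborel) + ennreal C * (\<integral>\<^sup>+x. ?b x \<partial>lborel)"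
    by (subst nn_integral_add) (auto simp: nn_integral_cmult)
  also have "\<dots> \<le> (\<integral>\<^sup>+x\<in>hyp_space. ennreal ((2 * l\<^sup>2 * (norm (G x) / hyp_factor x)\<^sup>2
          + max (C - (hyp_rho x / l)\<^sup>2) 0 * (u x)\<^sup>2) * ?g x) \<partial>lborel) + ennreal C * (\<integral>\<^sup>+x. ?b x \<partial>lborel)"
    unfolding C_def by (intro add_right_mono hyp_Lyapunov assms)
  also have "\<dots> \<le> (\<integral>\<^sup>+x. ennreal (2 * l\<^sup>2) * ?e x + ennreal C * ?b x \<partial>lborel) + ennreal C * (\<integral>\<^sup>+x. ?b x \<partial>lborel)"
  proof (intro add_right_mono nn_integral_mono)
    fix x :: 'a
    show "ennreal ((2 * l\<^sup>2 * (norm (G x) / hyp_factor x)\<^sup>2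
          + max (C - (hyp_rho x / l)\<^sup>2) 0 * (u x)\<^sup>2) * ?g x) * indicator hyp_space x
      \<le> ennreal (2 * l\<^sup>2) * ?e x + ennreal C * ?b x"
    proof (cases "x \<in> hyp_space")
      case True
      \<comment> \<open>The left side is nonzero only where \<open>\<tau>\<^sup>2 < C\<close>, which
        lies inside \<open>B\<close>.\<close>
      have "max (C - (hyp_rho x / l)\<^sup>2) 0 \<le> C * indicator B x"
        using B[OF True] \<open>C > 0\<close> by (auto simp: indicator_def)
      then have "(2 * l\<^sup>2 * (norm (G x) / hyp_factor x)\<^sup>2 + max (C - (hyp_rho x / l)\<^sup>2) 0 * (u x)\<^sup>2) * ?g x
          \<le> (2 * l\<^sup>2 * (norm (G x) / hyp_factor x)\<^sup>2 + C * indicator B x * (u x)\<^sup>2) * ?g x"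
        by (intro mult_right_mono add_left_mono hyp_gaussian_nonneg True) auto
      also have "\<dots> = 2 * l\<^sup>2 * ((norm (G x) / hyp_factor x)\<^sup>2 * ?g x) + C * ((u x)\<^sup>2 * ?g x * indicator B x)"
        by (simp add: algebra_simps)
      finally show ?thesis using True \<open>C > 0\<close> hyp_gaussian_nonneg[OF True, of l]
        by (simp add: ennreal_mult'[symmetric] ennreal_indicator[symmetric] ennreal_mult''[symmetric] ennreal_plus[symmetric] ennreal_leI del: ennreal_plus)
    qed auto
  qed
  also have "\<dots> = ennreal (2 * l\<^sup>2) * (\<integral>\<^sup>+x. ?e x \<partial>lborel) + (ennreal C + ennreal C) * (\<integral>\<^sup>+x. ?b x \<partial>lborel)"
    by (subst nn_integral_add) (auto simp: nn_integral_cmult distrib_right add.assoc)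
  also have "ennreal C + ennreal C = ennreal (2 * C)"
    using \<open>C > 0\<close> by (simp add: ennreal_plus[symmetric] del: ennreal_plus)
  finally show ?thesis .
qed

subsection \<open>The weighted Poincare inequality\<close>

text \<open>Here \<open>I\<close> plays the role of the infimum over constants. For each
  \<open>y\<close> in \<open>B\<close> the previous bound is applied to \<open>u - u y\<close>,
  which has the same gradient; averaging over \<open>y\<close> turns the local term into the double
  integral of the convex Poincare inequality. \<open>Q\<close> bounds the conformal factor on
  \<open>B\<close> for all \<open>l \<le> \<beta>\<close>.\<close>

lemma hyp_weighted_Poincare:
  fixes u :: "'a::euclidean_space \<Rightarrow> real"
  assumes [measurable]: "u \<in> borel_measurable borel" "G \<in> borel_measurable borel"
    and G: "continuous_on hyp_space G" "\<And>x. x \<in> hyp_space \<Longrightarrow> GDERIV u x :> G x"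
    and l: "0 < l" "l \<le> \<beta>"
    and I: "\<And>c. ennreal I \<le> (\<integral>\<^sup>+x\<in>hyp_space. ennreal ((u x - c)\<^sup>2 * hyp_gaussian l x) \<partial>lborel)"
  defines "C \<equiv> real DIM('a) + (real (DIM('a) - 1) * \<beta>)\<^sup>2 / 2"
  defines "Q \<equiv> 1 + exp (sqrt (2 * C) * \<beta>)"
  shows "ennreal (C * I) \<le> ennreal ((2 + 16 * C\<^sup>2 * Q ^ (DIM('a) + 2) * 2 ^ DIM('a) * exp (2 * C)) * l\<^sup>2)
    * (\<integral>\<^sup>+x\<in>hyp_space. ennreal ((norm (G x) / hyp_factor x)\<^sup>2 * hyp_gaussian l x) \<partial>lborel)"
proof -
  define R where "R = sqrt (2 * C)"
  define B where "B = {x::'a. x \<in> hyp_space \<and> hyp_rho x < R * l}"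
  define E where "E = (\<integral>\<^sup>+x\<in>hyp_space. ennreal ((norm (G x) / hyp_factor x)\<^sup>2 * hyp_gaussian l x) \<partial>lborel)"
  define b where "b y = (\<integral>\<^sup>+x\<in>B. ennreal ((u x - u y)\<^sup>2) \<partial>lborel)" for y
  have "C > 0" by (simp add: C_def add_pos_nonneg)
  then have R: "R > 0" "R\<^sup>2 = 2 * C" by (auto simp: R_def)
  have "Q \<ge> 1" by (simp add: Q_def)
  have Bball: "B = ball 0 ((exp (R * l) - 1) / (exp (R * l) + 1))"
    unfolding B_def by (rule hyp_rho_ball)
  then have [measurable]: "B \<in> sets borel" and "convex B" by auto
  \<comment> \<open>Positive radius gives \<open>B\<close> positive finite volume, which is
    cancelled at the end.\<close>
  have "0 < (exp (R * l) - 1) / (exp (R * l) + 1)"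
    using R l by (intro divide_pos_pos) (auto simp: add_pos_pos)
  then have "emeasure lborel B > 0" "emeasure lborel B < top"
    unfolding Bball by (auto simp: emeasure_ball ennreal_zero_less_mult_iff intro!: mult_pos_pos)
  have inB: "x \<in> hyp_space" "norm x \<le> R * l" "hyp_factor x \<le> Q" "(hyp_rho x)\<^sup>2 / l\<^sup>2 \<le> 2 * C" if "x \<in> B" for x
  proof -
    show x: "x \<in> hyp_space" using that by (simp add: B_def)
    then show "norm x \<le> R * l" using norm_le_hyp_rho[OF x] that by (simp add: B_def)
    have "hyp_rho x \<le> R * l" using that by (simp add: B_def)
    also have "\<dots> \<le> R * \<beta>" using l R by simp
    finally show "hyp_factor x \<le> Q"
      using hyp_factor_le[OF x] by (simp add: Q_def R_def) (meson add_left_mono exp_le_cancel_iff order_trans)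
    have "(hyp_rho x)\<^sup>2 \<le> (R * l)\<^sup>2"
      using order_trans[OF norm_ge_zero norm_le_hyp_rho[OF x]] that by (intro power_mono) (auto simp: B_def)
    then show "(hyp_rho x)\<^sup>2 / l\<^sup>2 \<le> 2 * C"
      using l R(2) by (simp add: power_mult_distrib pos_divide_le_eq)
  qed
  \<comment> \<open>On \<open>B\<close> the Gaussian density is at most \<open>Q ^ DIM('a)\<close>,
    so the local term is compared with the unweighted integral \<open>b y\<close>.\<close>
  have point: "ennreal (C * I) \<le> ennreal (2 * l\<^sup>2) * E + ennreal (2 * C * Q ^ DIM('a)) * b y" if "y \<in> B" for y
  proof -
    have "(\<integral>\<^sup>+x\<in>B. ennreal ((u x - u y)\<^sup>2 * hyp_gaussian l x) \<partial>lborel)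
        \<le> (\<integral>\<^sup>+x. ennreal (Q ^ DIM('a)) * (ennreal ((u x - u y)\<^sup>2) * indicator B x) \<partial>lborel)"
    proof (rule nn_integral_mono)
      fix x
      have "(u x - u y)\<^sup>2 * hyp_gaussian l x \<le> Q ^ DIM('a) * (u x - u y)\<^sup>2" if "x \<in> B"
      proof -
        have "hyp_gaussian l x \<le> 1 * Q ^ DIM('a)"
          unfolding hyp_gaussian_def using inB[OF that] hyp_factor_ge_1[OF inB(1)[OF that]] by (intro mult_mono power_mono) auto
        then show ?thesis by (simp add: mult.commute[of "(u x - u y)\<^sup>2"] mult_right_mono)
      qed
      then show "ennreal ((u x - u y)\<^sup>2 * hyp_gaussian l x) * indicator B x
          \<le> ennreal (Q ^ DIM('a)) * (ennreal ((u x - u y)\<^sup>2) * indicator B x)"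
        using \<open>Q \<ge> 1\<close> by (auto simp: indicator_def ennreal_mult'[symmetric] intro!: ennreal_leI)
    qed
    also have "\<dots> = ennreal (Q ^ DIM('a)) * b y"
      unfolding b_def by (rule nn_integral_cmult) measurable
    finally have ball: "(\<integral>\<^sup>+x\<in>B. ennreal ((u x - u y)\<^sup>2 * hyp_gaussian l x) \<partial>lborel) \<le> ennreal (Q ^ DIM('a)) * b y" .
    have "ennreal (C * I) \<le> ennreal C * (\<integral>\<^sup>+x\<in>hyp_space. ennreal ((u x - u y)\<^sup>2 * hyp_gaussian l x) \<partial>lborel)"
      using I[of "u y"] \<open>C > 0\<close> by (simp add: ennreal_mult' mult_left_mono)
    also have "\<dots> \<le> ennreal (2 * l\<^sup>2) * E + ennreal (2 * C) * (\<integral>\<^sup>+x\<in>B. ennreal ((u x - u y)\<^sup>2 * hyp_gaussian l x) \<partial>lborel)"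
      unfolding E_def B_def R_def C_def
      by (rule hyp_L2_le_energy_plus_ball[OF _ _ G(1) _ l])
        (auto intro!: GDERIV_subst[OF GDERIV_diff[OF G(2) GDERIV_const]])
    also have "\<dots> \<le> ennreal (2 * l\<^sup>2) * E + ennreal (2 * C) * (ennreal (Q ^ DIM('a)) * b y)"
      by (intro add_left_mono mult_left_mono ball) simp
    also have "ennreal (2 * C) * (ennreal (Q ^ DIM('a)) * b y) = ennreal (2 * C * Q ^ DIM('a)) * b y"
      using \<open>C > 0\<close> \<open>Q \<ge> 1\<close> by (simp only: mult.assoc[symmetric]) (subst ennreal_mult, auto)
    finally show ?thesis .
  qed
  \<comment> \<open>The diameter \<open>2 * (R * l)\<close> has square
    \<open>8 * C * l\<^sup>2\<close>. Passing back to the hyperbolic energy costs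
    \<open>Q\<^sup>2\<close> for the metric and \<open>exp (2 * C)\<close> for the Gaussian, since
    \<open>\<tau>\<^sup>2 \<le> 2 * C\<close> on \<open>B\<close>.\<close>
  have local: "(\<integral>\<^sup>+y\<in>B. b y \<partial>lborel) \<le> ennreal (8 * C * l\<^sup>2 * 2 ^ DIM('a) * (Q\<^sup>2 * exp (2 * C))) * emeasure lborel B * E"
  proof -
    have "(\<integral>\<^sup>+y\<in>B. b y \<partial>lborel) \<le> ennreal ((2 * (R * l))\<^sup>2) * ennreal (2 ^ DIM('a)) * emeasure lborel B * (\<integral>\<^sup>+x\<in>B. ennreal ((norm (G x))\<^sup>2) \<partial>lborel)"
      unfolding b_def
    proof (rule Poincare_convex[OF \<open>convex B\<close>])
      fix x y assume "x \<in> B" "y \<in> B"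
      then show "dist x y \<le> 2 * (R * l)"
        using inB(2)[of x] inB(2)[of y] norm_triangle_ineq4[of x y] by (simp add: dist_norm)
    qed (use G inB(1) in \<open>auto intro: continuous_on_subset\<close>)
    also have "(\<integral>\<^sup>+x\<in>B. ennreal ((norm (G x))\<^sup>2) \<partial>lborel)
        \<le> (\<integral>\<^sup>+x. ennreal (Q\<^sup>2 * exp (2 * C)) * (ennreal ((norm (G x) / hyp_factor x)\<^sup>2 * hyp_gaussian l x) * indicator hyp_space x) \<partial>lborel)"
    proof (rule nn_integral_mono)
      fix x
      have "(norm (G x))\<^sup>2 \<le> Q\<^sup>2 * exp (2 * C) * ((norm (G x) / hyp_factor x)\<^sup>2 * hyp_gaussian l x)" if "x \<in> B"
      proof -
        let ?q = "hyp_factor x"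
        have q: "1 \<le> ?q" "?q \<le> Q" using hyp_factor_ge_1 inB that by auto
        have "exp (- (2 * C)) * 1 \<le> hyp_gaussian l x"
          unfolding hyp_gaussian_def using inB(4)[OF that] q by (intro mult_mono) (auto simp: one_le_power)
        then have "1 \<le> exp (2 * C) * hyp_gaussian l x"
          by (simp add: exp_minus field_simps)
        moreover have "(norm (G x))\<^sup>2 \<le> Q\<^sup>2 * (norm (G x) / ?q)\<^sup>2"
        proof -
          have "(norm (G x))\<^sup>2 = ?q\<^sup>2 * (norm (G x) / ?q)\<^sup>2" using q by (simp add: power_divide)
          also have "\<dots> \<le> Q\<^sup>2 * (norm (G x) / ?q)\<^sup>2" using q by (intro mult_right_mono power_mono) auto
          finally show ?thesis .
        qed
        ultimately have "(norm (G x))\<^sup>2 * 1 \<le> (Q\<^sup>2 * (norm (G x) / ?q)\<^sup>2) * (exp (2 * C) * hyp_gaussian l x)"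
          by (intro mult_mono) auto
        then show ?thesis by (simp add: mult_ac)
      qed
      then show "ennreal ((norm (G x))\<^sup>2) * indicator B x
        \<le> ennreal (Q\<^sup>2 * exp (2 * C)) * (ennreal ((norm (G x) / hyp_factor x)\<^sup>2 * hyp_gaussian l x) * indicator hyp_space x)"
        using inB(1) by (auto simp: indicator_def ennreal_mult'[symmetric] intro!: ennreal_leI)
    qed
    also have "\<dots> = ennreal (Q\<^sup>2 * exp (2 * C)) * E"
      unfolding E_def by (rule nn_integral_cmult) measurable
    also have "ennreal ((2 * (R * l))\<^sup>2) * ennreal (2 ^ DIM('a)) * emeasure lborel B * (ennreal (Q\<^sup>2 * exp (2 * C)) * E)
      = (ennreal ((2 * (R * l))\<^sup>2) * ennreal (2 ^ DIM('a)) * ennreal (Q\<^sup>2 * exp (2 * C))) * emeasure lborel B * E"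
      by (simp only: mult_ac)
    also have "ennreal ((2 * (R * l))\<^sup>2) * ennreal (2 ^ DIM('a)) * ennreal (Q\<^sup>2 * exp (2 * C)) = ennreal (8 * C * l\<^sup>2 * 2 ^ DIM('a) * (Q\<^sup>2 * exp (2 * C)))"
      using \<open>C > 0\<close> by (simp add: ennreal_mult[symmetric] power_mult_distrib R(2))
    finally show ?thesis by (simp add: mult_left_mono)
  qed
  have [measurable]: "b \<in> borel_measurable borel"
    unfolding b_def by measurable
  have "ennreal (C * I) * emeasure lborel B = (\<integral>\<^sup>+y\<in>B. ennreal (C * I) \<partial>lborel)"
    by (simp add: nn_integral_cmult_indicator)
  also have "\<dots> \<le> (\<integral>\<^sup>+y. ennreal (2 * l\<^sup>2) * E * indicator B y + ennreal (2 * C * Q ^ DIM('a)) * (b y * indicator B y) \<partial>lborel)"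
    using point by (intro nn_integral_mono) (auto simp: indicator_def)
  also have "\<dots> = ennreal (2 * l\<^sup>2) * E * emeasure lborel B + ennreal (2 * C * Q ^ DIM('a)) * (\<integral>\<^sup>+y\<in>B. b y \<partial>lborel)"
    by (subst nn_integral_add) (auto simp: nn_integral_cmult nn_integral_cmult_indicator)
  also have "\<dots> \<le> ennreal (2 * l\<^sup>2) * E * emeasure lborel B
      + ennreal (2 * C * Q ^ DIM('a)) * (ennreal (8 * C * l\<^sup>2 * 2 ^ DIM('a) * (Q\<^sup>2 * exp (2 * C))) * emeasure lborel B * E)"
    by (intro add_left_mono mult_left_mono local) auto
  also have "\<dots> = (ennreal (2 * l\<^sup>2) + ennreal (2 * C * Q ^ DIM('a)) * ennreal (8 * C * l\<^sup>2 * 2 ^ DIM('a) * (Q\<^sup>2 * exp (2 * C)))) * E * emeasure lborel B"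
    by (simp only: distrib_right) (simp only: mult_ac)
  also have "ennreal (2 * l\<^sup>2) + ennreal (2 * C * Q ^ DIM('a)) * ennreal (8 * C * l\<^sup>2 * 2 ^ DIM('a) * (Q\<^sup>2 * exp (2 * C)))
      = ennreal (2 * l\<^sup>2 + 2 * C * Q ^ DIM('a) * (8 * C * l\<^sup>2 * 2 ^ DIM('a) * (Q\<^sup>2 * exp (2 * C))))"
    using \<open>C > 0\<close> \<open>Q \<ge> 1\<close> by (subst ennreal_mult[symmetric]) (auto simp: ennreal_plus)
  also have "2 * l\<^sup>2 + 2 * C * Q ^ DIM('a) * (8 * C * l\<^sup>2 * 2 ^ DIM('a) * (Q\<^sup>2 * exp (2 * C)))
      = (2 + 16 * C\<^sup>2 * Q ^ (DIM('a) + 2) * 2 ^ DIM('a) * exp (2 * C)) * l\<^sup>2"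
    by (simp only: power_add power2_eq_square) (simp add: algebra_simps)
  finally have "emeasure lborel B * ennreal (C * I) \<le> emeasure lborel B
      * (ennreal ((2 + 16 * C\<^sup>2 * Q ^ (DIM('a) + 2) * 2 ^ DIM('a) * exp (2 * C)) * l\<^sup>2) * E)"
    by (simp only: mult.commute)
  then show ?thesis
    using \<open>emeasure lborel B > 0\<close> \<open>emeasure lborel B < top\<close>
    unfolding E_def[symmetric] by (subst (asm) ennreal_mult_le_mult_iff) auto
qed

section \<open>Integrals over the hyperbolic volume and gradients of test functions\<close>

lemma nn_integral_hyp_volume:
  fixes f :: "'a::euclidean_space \<Rightarrow> real"
  assumes [measurable]: "f \<in> borel_measurable borel"
  shows "(\<integral>\<^sup>+x. ennreal (f x) \<partial>hyp_volume) = (\<integral>\<^sup>+x\<in>hyp_space. ennreal (f x * hyp_factor x ^ DIM('a)) \<partial>lborel)"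
proof -
  have "(\<integral>\<^sup>+x. ennreal (f x) \<partial>hyp_volume)
      = (\<integral>\<^sup>+x. ennreal (hyp_factor x ^ DIM('a)) * ennreal (f x) \<partial>restrict_space lborel hyp_space)"
    unfolding hyp_volume_def by (intro nn_integral_density) (auto intro!: measurable_restrict_space1)
  also have "\<dots> = (\<integral>\<^sup>+x\<in>hyp_space. ennreal (hyp_factor x ^ DIM('a)) * ennreal (f x) \<partial>lborel)"
    by (rule nn_integral_restrict_space) simp
  also have "\<dots> = (\<integral>\<^sup>+x\<in>hyp_space. ennreal (f x * hyp_factor x ^ DIM('a)) \<partial>lborel)"
  proof (rule nn_integral_cong)
    fix x :: 'a
    show "ennreal (hyp_factor x ^ DIM('a)) * ennreal (f x) * indicator hyp_space x = ennreal (f x * hyp_factor x ^ DIM('a)) * indicator hyp_space x"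
      using hyp_factor_ge_1[of x] by (auto simp: indicator_def ennreal_mult'' mult.commute)
  qed
  finally show ?thesis .
qed

text \<open>The measure lives on the ball, so \<open>f\<close> may be replaced by a function
  \<open>g\<close> that is Borel on the whole space. If the integral diverges, both sides take the
  default value 0.\<close>

lemma hyp_volume_integral:
  fixes f g :: "'a::euclidean_space \<Rightarrow> real"
  assumes [measurable]: "g \<in> borel_measurable borel" and "\<And>x. 0 \<le> g x"
    and "\<And>x. x \<in> hyp_space \<Longrightarrow> f x = g x"
  shows "(\<integral>x. f x \<partial>hyp_volume) = enn2real (\<integral>\<^sup>+x\<in>hyp_space. ennreal (g x * hyp_factor x ^ DIM('a)) \<partial>lborel)"
proof -
  have "(\<integral>x. f x \<partial>hyp_volume) = (\<integral>x. g x \<partial>hyp_volume)"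
    by (rule Bochner_Integration.integral_cong) (auto simp: hyp_volume_def space_restrict_space assms(3))
  also have "\<dots> = enn2real (\<integral>\<^sup>+x. ennreal (g x) \<partial>hyp_volume)"
    by (rule integral_eq_nn_integral)
      (auto simp: hyp_volume_def assms(2) intro!: measurable_restrict_space1)
  finally show ?thesis by (simp add: nn_integral_hyp_volume)
qed

text \<open>Differentiability and uniqueness of the gradient make the definite description
  meaningful, and the partial derivatives give its continuity. The compact set makes the energy
  finite.\<close>

lemma hyp_test_function_gradient:
  fixes u :: "'a::euclidean_space \<Rightarrow> real"
  assumes "u \<in> hyp_test_functions"
  shows "x \<in> hyp_space \<Longrightarrow> GDERIV u x :> euclidean_gradient u x"
    and "continuous_on hyp_space (euclidean_gradient u)"
    and "\<exists>K. compact K \<and> K \<subseteq> hyp_space \<and> (\<forall>x\<in>hyp_space - K. euclidean_gradient u x = 0)"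
proof -
  define g where "g x = (\<Sum>b\<in>Basis. frechet_derivative u (at x) b *\<^sub>R b)" for x
  have "Ck_on (Suc 0) hyp_space u"
    using assms by (auto simp: hyp_test_functions_def smooth_on_def)
  then have diff: "\<And>x. x \<in> hyp_space \<Longrightarrow> u differentiable (at x)"
    and cont: "\<And>b. b \<in> Basis \<Longrightarrow> continuous_on hyp_space (\<lambda>x. frechet_derivative u (at x) b)"
    by auto
  have uniq: "euclidean_gradient u x = D" if "GDERIV u x :> D" for x D
    unfolding euclidean_gradient_def
  proof (rule the_equality)
    show "GDERIV u x :> D" by (rule that)
    fix D' assume "GDERIV u x :> D'"
    then have "(\<lambda>h. h \<bullet> D') = (\<lambda>h. h \<bullet> D)"
      using that unfolding gderiv_def by (rule has_derivative_unique)
    then show "D' = D" by (metis inner_commute vector_eq_ldot)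
  qed
  have g: "GDERIV u x :> g x" if "x \<in> hyp_space" for x
  proof -
    have d: "(u has_derivative frechet_derivative u (at x)) (at x)"
      using diff[OF that] by (simp add: frechet_derivative_works)
    then interpret linear "frechet_derivative u (at x)" by (rule has_derivative_linear)
    have "frechet_derivative u (at x) h = h \<bullet> g x" for h
    proof -
      have "frechet_derivative u (at x) h = frechet_derivative u (at x) (\<Sum>b\<in>Basis. (h \<bullet> b) *\<^sub>R b)"
        by (simp only: euclidean_representation)
      also have "\<dots> = h \<bullet> g x"
        by (simp add: sum scaleR g_def inner_sum_right mult.commute)
      finally show ?thesis .
    qed
    then have "frechet_derivative u (at x) = (\<lambda>h. h \<bullet> g x)" by auto
    with d show ?thesis by (simp add: gderiv_def)
  qed
  then have eq: "euclidean_gradient u x = g x" if "x \<in> hyp_space" for x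
    using uniq that by blast
  show "x \<in> hyp_space \<Longrightarrow> GDERIV u x :> euclidean_gradient u x"
    using g eq by simp
  have "continuous_on hyp_space g"
    unfolding g_def by (intro continuous_intros cont)
  then show "continuous_on hyp_space (euclidean_gradient u)"
    by (subst continuous_on_cong[OF refl eq]) auto
  define K where "K = closure (support_on hyp_space u)"
  have K: "compact K" "K \<subseteq> hyp_space"
    using assms by (auto simp: hyp_test_functions_def K_def)
  have "euclidean_gradient u x = 0" if "x \<in> hyp_space - K" for x
  proof (rule uniq)
    \<comment> \<open>A zero of \<open>u\<close> alone does not determine the derivative there;
      \<open>u\<close> vanishes on the whole open set \<open>hyp_space - K\<close>.\<close>
    have "u y = 0" if "y \<in> hyp_space - K" for y
      using that closure_subset[of "support_on hyp_space u"] by (auto simp: K_def in_support_on)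
    moreover have "open (hyp_space - K)"
      using K by (intro open_Diff) (auto simp: compact_imp_closed)
    ultimately show "GDERIV u x :> 0"
      using that has_derivative_transform_within_open[of "\<lambda>_. 0" "\<lambda>_. 0" x UNIV "hyp_space - K" u]
      by (simp add: gderiv_def)
  qed
  with K show "\<exists>K. compact K \<and> K \<subseteq> hyp_space \<and> (\<forall>x\<in>hyp_space - K. euclidean_gradient u x = 0)"
    by blast
qed

lemma continuous_on_hyp_rho: "continuous_on hyp_space hyp_rho"
  unfolding hyp_rho_def[abs_def]
  by (intro continuous_intros) (auto simp: add_pos_nonneg[THEN less_imp_neq, symmetric])

lemma continuous_on_hyp_factor: "continuous_on hyp_space hyp_factor"
  unfolding hyp_factor_def[abs_def]
  by (intro continuous_intros) (force simp: abs_square_eq_1)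

text \<open>Transfers the estimate to Bochner integrals. The energy has to be converted exactly, and
  its finiteness follows from the compact support of the gradient; for the left side an inequality
  suffices.\<close>

lemma hyp_Poincare:
  fixes u :: "'a::euclidean_space \<Rightarrow> real"
  assumes u: "u \<in> hyp_test_functions" and l: "0 < l" "l \<le> \<beta>"
  defines "C \<equiv> real DIM('a) + (real (DIM('a) - 1) * \<beta>)\<^sup>2 / 2"
  defines "Q \<equiv> 1 + exp (sqrt (2 * C) * \<beta>)"
  shows "C * (INF c::real. \<integral>x. \<bar>u x - c\<bar>\<^sup>2 * exp (- ((hyp_rho x)\<^sup>2 / l\<^sup>2)) \<partial>hyp_volume)
    \<le> (2 + 16 * C\<^sup>2 * Q ^ (DIM('a) + 2) * 2 ^ DIM('a) * exp (2 * C)) * l\<^sup>2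
      * (\<integral>x. (hyp_norm x (hyp_gradient u x))\<^sup>2 * exp (- ((hyp_rho x)\<^sup>2 / l\<^sup>2)) \<partial>hyp_volume)"
proof -
  \<comment> \<open>Values outside the ball are arbitrary, so both functions are cut off to become
    Borel on the whole space.\<close>
  define v where "v x = indicator hyp_space x *\<^sub>R u x" for x
  define G where "G x = indicator hyp_space x *\<^sub>R euclidean_gradient u x" for x
  let ?J = "\<lambda>c::real. \<integral>x. \<bar>u x - c\<bar>\<^sup>2 * exp (- ((hyp_rho x)\<^sup>2 / l\<^sup>2)) \<partial>hyp_volume"
  let ?F = "\<lambda>x. (norm (G x) / hyp_factor x)\<^sup>2 * exp (- ((hyp_rho x)\<^sup>2 / l\<^sup>2))"
  let ?E = "\<integral>\<^sup>+x\<in>hyp_space. ennreal ((norm (G x) / hyp_factor x)\<^sup>2 * hyp_gaussian l x) \<partial>lborel"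
  have contu: "continuous_on hyp_space u"
    using u by (auto simp: hyp_test_functions_def smooth_on_def dest: spec[of _ 0])
  have [measurable]: "v \<in> borel_measurable borel" "G \<in> borel_measurable borel"
    unfolding v_def G_def using contu hyp_test_function_gradient(2)[OF u]
    by (auto simp del: real_scaleR_def intro!: borel_measurable_continuous_on_indicator)
  have G: "continuous_on hyp_space G"
    using hyp_test_function_gradient(2)[OF u] by (rule continuous_on_eq) (simp add: G_def)
  have vG: "GDERIV v x :> G x" if "x \<in> hyp_space" for x
    using has_derivative_transform_within_open[of u _ x UNIV hyp_space v]
      hyp_test_function_gradient(1)[OF u that] that by (auto simp: gderiv_def v_def G_def)
  obtain K where K: "compact K" "K \<subseteq> hyp_space" "\<forall>x\<in>hyp_space - K. euclidean_gradient u x = 0"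
    using hyp_test_function_gradient(3)[OF u] by blast
  have "continuous_on K (\<lambda>x. (norm (G x) / hyp_factor x)\<^sup>2 * hyp_gaussian l x)"
  proof (rule continuous_on_subset[OF _ K(2)])
    show "continuous_on hyp_space (\<lambda>x. (norm (G x) / hyp_factor x)\<^sup>2 * hyp_gaussian l x)"
      unfolding hyp_gaussian_def using l hyp_factor_ge_1
      by (intro continuous_intros G continuous_on_hyp_rho continuous_on_hyp_factor) force+
  qed
  then have int: "integrable lborel (\<lambda>x. indicator K x *\<^sub>R ((norm (G x) / hyp_factor x)\<^sup>2 * hyp_gaussian l x))"
    by (rule borel_integrable_compact[OF K(1)])
  have "?E = (\<integral>\<^sup>+x. ennreal (indicator K x *\<^sub>R ((norm (G x) / hyp_factor x)\<^sup>2 * hyp_gaussian l x)) \<partial>lborel)"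
    using K(2,3) by (intro nn_integral_cong) (auto simp: indicator_def G_def)
  also have "\<dots> < \<infinity>"
    using K(2) hyp_gaussian_nonneg
    by (subst nn_integral_eq_integral[OF int]) (auto intro!: AE_I2 mult_nonneg_nonneg simp: indicator_def subset_iff)
  finally have E: "?E < \<infinity>" .
  have "(\<integral>x. (hyp_norm x (hyp_gradient u x))\<^sup>2 * exp (- ((hyp_rho x)\<^sup>2 / l\<^sup>2)) \<partial>hyp_volume)
      = enn2real (\<integral>\<^sup>+x\<in>hyp_space. ennreal (?F x * hyp_factor x ^ DIM('a)) \<partial>lborel)"
  proof (rule hyp_volume_integral)
    fix x :: 'a assume x: "x \<in> hyp_space"
    then have q: "(1 - (norm x)\<^sup>2) / 2 = 1 / hyp_factor x" "hyp_factor x \<noteq> 0"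
      using hyp_factor_ge_1[OF x] by (auto simp: hyp_factor_def)
    \<comment> \<open>With \<open>q = hyp_factor x\<close>, the gradient carries
      \<open>1 / q\<^sup>2\<close> and the Riemannian norm a factor \<open>q\<close>, leaving
      \<open>1 / q\<close>.\<close>
    have "(hyp_norm x (hyp_gradient u x))\<^sup>2 = (norm (G x) / hyp_factor x)\<^sup>2"
      using x q(2) unfolding hyp_norm_def hyp_inner_def hyp_gradient_def q(1)
      by (simp add: G_def power2_norm_eq_inner[symmetric] power_divide field_simps power2_eq_square)
    then show "(hyp_norm x (hyp_gradient u x))\<^sup>2 * exp (- ((hyp_rho x)\<^sup>2 / l\<^sup>2)) = ?F x" by simp
  qed auto
  also have "(\<integral>\<^sup>+x\<in>hyp_space. ennreal (?F x * hyp_factor x ^ DIM('a)) \<partial>lborel) = ?E"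
    by (simp add: hyp_gaussian_def mult.assoc)
  finally have energy: "ennreal (\<integral>x. (hyp_norm x (hyp_gradient u x))\<^sup>2 * exp (- ((hyp_rho x)\<^sup>2 / l\<^sup>2)) \<partial>hyp_volume) = ?E"
    using E by simp
  have Jc: "?J c = enn2real (\<integral>\<^sup>+x\<in>hyp_space. ennreal ((v x - c)\<^sup>2 * hyp_gaussian l x) \<partial>lborel)" for c
  proof -
    have "?J c = enn2real (\<integral>\<^sup>+x\<in>hyp_space. ennreal ((v x - c)\<^sup>2 * exp (- ((hyp_rho x)\<^sup>2 / l\<^sup>2)) * hyp_factor x ^ DIM('a)) \<partial>lborel)"
      by (rule hyp_volume_integral, measurable) (auto simp: v_def)
    then show ?thesis by (simp add: hyp_gaussian_def mult.assoc)
  qed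
  have "bdd_below (range ?J)" by (rule bdd_belowI[of _ 0]) (auto simp: Jc)
  then have INF_le: "(INF c. ?J c) \<le> ?J c" for c by (rule cINF_lower) simp
  have "ennreal (INF c. ?J c) \<le> (\<integral>\<^sup>+x\<in>hyp_space. ennreal ((v x - c)\<^sup>2 * hyp_gaussian l x) \<partial>lborel)" for c
  proof -
    have "ennreal (INF c. ?J c) \<le> ennreal (?J c)" by (intro ennreal_leI INF_le)
    \<comment> \<open>If the right side is infinite, \<open>enn2real\<close> returns 0 and the
      inequality still holds.\<close>
    also have "\<dots> \<le> (\<integral>\<^sup>+x\<in>hyp_space. ennreal ((v x - c)\<^sup>2 * hyp_gaussian l x) \<partial>lborel)"
      unfolding Jc by (cases "\<integral>\<^sup>+x\<in>hyp_space. ennreal ((v x - c)\<^sup>2 * hyp_gaussian l x) \<partial>lborel") auto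
    finally show ?thesis .
  qed
  from hyp_weighted_Poincare[OF _ _ G vG l this]
  have "ennreal (C * (INF c. ?J c)) \<le> ennreal ((2 + 16 * C\<^sup>2 * Q ^ (DIM('a) + 2) * 2 ^ DIM('a) * exp (2 * C)) * l\<^sup>2) * ?E"
    by (simp add: C_def Q_def)
  moreover have "0 \<le> (2 + 16 * C\<^sup>2 * Q ^ (DIM('a) + 2) * 2 ^ DIM('a) * exp (2 * C)) * l\<^sup>2"
    by (simp add: Q_def add_nonneg_nonneg)
  ultimately show ?thesis
    by (simp add: energy[symmetric] ennreal_mult'[symmetric])
qed

theorem theorem1p5:
  assumes "CARD('n::finite) \<ge> 2"
  shows "\<forall>\<beta>::real. \<beta> > 0 \<longrightarrow>
    (\<exists>K::real. K > 0 \<and>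
      (\<forall>u \<in> (hyp_test_functions :: (real ^ 'n \<Rightarrow> real) set). \<forall>l \<in> {0<..\<beta>}.
        l\<^sup>2 / 2 *
          (\<integral>x. (hyp_norm x (hyp_gradient u x))\<^sup>2 * exp (- ((hyp_rho x)\<^sup>2 / l\<^sup>2)) \<partial>hyp_volume)
        \<ge> K * (INF c::real. \<integral>x. \<bar>u x - c\<bar>\<^sup>2 * exp (- ((hyp_rho x)\<^sup>2 / l\<^sup>2)) \<partial>hyp_volume)))"
proof (intro allI impI)
  fix \<beta> :: real assume "\<beta> > 0"
  define N where "N = DIM(real ^ 'n)"
  define C where "C = real N + (real (N - 1) * \<beta>)\<^sup>2 / 2"
  define M where "M = 2 + 16 * C\<^sup>2 * (1 + exp (sqrt (2 * C) * \<beta>)) ^ (N + 2) * 2 ^ N * exp (2 * C)"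
  have "C > 0" "M > 0"
    by (simp_all add: C_def M_def N_def add_pos_nonneg)
  \<comment> \<open>The estimate \<open>C * INF \<le> M * l\<^sup>2 * energy\<close> is divided by
    \<open>2 * M\<close>; both constants depend only on the dimension and
    \<open>\<beta>\<close>.\<close>
  have "C / (2 * M) * (INF c::real. \<integral>x. \<bar>u x - c\<bar>\<^sup>2 * exp (- ((hyp_rho x)\<^sup>2 / l\<^sup>2)) \<partial>hyp_volume)
      \<le> l\<^sup>2 / 2 * (\<integral>x. (hyp_norm x (hyp_gradient u x))\<^sup>2 * exp (- ((hyp_rho x)\<^sup>2 / l\<^sup>2)) \<partial>hyp_volume)"
    if "u \<in> hyp_test_functions" "l \<in> {0<..\<beta>}" for u :: "real ^ 'n \<Rightarrow> real" and l
    using hyp_Poincare[of u l \<beta>] that \<open>M > 0\<close>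
    unfolding N_def[symmetric] C_def[symmetric] M_def[symmetric] by (simp add: field_simps)
  then show "\<exists>K>0. \<forall>u \<in> (hyp_test_functions :: (real ^ 'n \<Rightarrow> real) set). \<forall>l \<in> {0<..\<beta>}.
        l\<^sup>2 / 2 *
          (\<integral>x. (hyp_norm x (hyp_gradient u x))\<^sup>2 * exp (- ((hyp_rho x)\<^sup>2 / l\<^sup>2)) \<partial>hyp_volume)
        \<ge> K * (INF c::real. \<integral>x. \<bar>u x - c\<bar>\<^sup>2 * exp (- ((hyp_rho x)\<^sup>2 / l\<^sup>2)) \<partial>hyp_volume)"
    using \<open>C > 0\<close> \<open>M > 0\<close> by (intro exI[of _ "C / (2 * M)"]) auto
qed

end
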